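(* For any $\varepsilon>0$ and any $0<\alpha\leq 1-\varepsilon$, the problem $\mathsf{MCSP}[n^{\alpha}]$ on inputs of length $n$ does not have comparator circuits with $n^{1+\alpha/2-\varepsilon}$ gates (for all sufficiently large $n$).
   Context: $\mathsf{MCSP}[n^{\alpha}]$ is the problem: given an $n$-bit string (with $n$ a power of two) viewed as the truth table of a Boolean function on $\log n$ variables, decide whether this function can be computed by some general Boolean circuit of size at most $n^{\alpha}$. A comparator circuit on $n$ variables consists of a set of wires, each labelled by an input literal ($x_i$ or $\neg x_i$), a sequence of gates, each an ordered pair of distinct wires $(w_i,w_j)$, and a designated output wire. On input $a\in\{0,1\}^n$, wires are initialised with the values of their literals and each gate $(w_i,w_j)$ in order replaces the current values $(u,v)$ by $(u\wedge v,u\vee v)$; the final value of the output wire is the output. The size is the number of gates. *)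

theory Defs
  imports Complex_Main
begin

section \<open>Comparator circuits\<close>

datatype input_literal = Pos nat | Neg nat

fun lit_var :: "input_literal \<Rightarrow> nat" where
  "lit_var (Pos i) = i"
| "lit_var (Neg i) = i"

fun lit_value :: "bool list \<Rightarrow> input_literal \<Rightarrow> bool" where
  "lit_value a (Pos i) = a ! i"
| "lit_value a (Neg i) = (\<not> a ! i)"

text \<open>
  The wires are numbered by the positions of the list of their labels. The same literal may
  label several wires, and the number of wires is not counted in the size.
\<close>

record comparator_circuit =
  wire_labels :: "input_literal list"
  cgates :: "(nat \<times> nat) list"
  output_wire :: nat

definition wf_comparator_circuit :: "nat \<Rightarrow> comparator_circuit \<Rightarrow> bool" where
  "wf_comparator_circuit n C \<longleftrightarrow>
     (\<forall>l \<in> set (wire_labels C). lit_var l < n) \<and>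
     (\<forall>(i, j) \<in> set (cgates C).
        i < length (wire_labels C) \<and> j < length (wire_labels C) \<and> i \<noteq> j) \<and>
     output_wire C < length (wire_labels C)"

definition cgate_step :: "nat \<times> nat \<Rightarrow> bool list \<Rightarrow> bool list" where
  "cgate_step g w = (case g of (i, j) \<Rightarrow> w[i := w ! i \<and> w ! j, j := w ! i \<or> w ! j])"

definition comparator_eval :: "comparator_circuit \<Rightarrow> bool list \<Rightarrow> bool" where
  "comparator_eval C a =
     fold cgate_step (cgates C) (map (lit_value a) (wire_labels C)) ! output_wire C"

definition comparator_size :: "comparator_circuit \<Rightarrow> nat" where
  "comparator_size C = length (cgates C)"

section \<open>General Boolean circuits\<close>

text \<open>
  Circuits over AND, OR (of fan-in two) and NOT with unbounded fan-out, as straight-line programs: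
  in a circuit on \<open>m\<close> variables, nodes \<open>0, \<dots>, m - 1\<close> are the inputs and node \<open>m + k\<close> is the \<open>k\<close>-th
  gate, which may only refer to earlier nodes. All gates, NOT gates included, count towards the
  size; the input nodes do not. The output may be any node.
\<close>

datatype bgate = And nat nat | Or nat nat | Not nat

fun bgate_args :: "bgate \<Rightarrow> nat set" where
  "bgate_args (And i j) = {i, j}"
| "bgate_args (Or i j) = {i, j}"
| "bgate_args (Not i) = {i}"

fun bgate_value :: "bool list \<Rightarrow> bgate \<Rightarrow> bool" where
  "bgate_value v (And i j) = (v ! i \<and> v ! j)"
| "bgate_value v (Or i j) = (v ! i \<or> v ! j)"
| "bgate_value v (Not i) = (\<not> v ! i)"

record boolean_circuit =
  bgates :: "bgate list"
  output_node :: nat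

definition wf_boolean_circuit :: "nat \<Rightarrow> boolean_circuit \<Rightarrow> bool" where
  "wf_boolean_circuit m B \<longleftrightarrow>
     (\<forall>k < length (bgates B). \<forall>i \<in> bgate_args (bgates B ! k). i < m + k) \<and>
     output_node B < m + length (bgates B)"

definition boolean_eval :: "boolean_circuit \<Rightarrow> bool list \<Rightarrow> bool" where
  "boolean_eval B x = fold (\<lambda>g v. v @ [bgate_value v g]) (bgates B) x ! output_node B"

definition boolean_size :: "boolean_circuit \<Rightarrow> nat" where
  "boolean_size B = length (bgates B)"

section \<open>The minimum circuit size problem\<close>

text \<open>
  The entry for the assignment \<open>x\<close> stands at the position with binary expansion \<open>x\<close>, least
  significant bit first. The opposite bit order only permutes the variables.
\<close>

definition truth_table_fun :: "bool list \<Rightarrow> bool list \<Rightarrow> bool" where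
  "truth_table_fun t x = t ! horner_sum of_bool 2 x"

text \<open>The size bound is a function of the length \<open>2 ^ m\<close> of the truth table, not of \<open>m\<close>.\<close>

definition MCSP :: "(nat \<Rightarrow> real) \<Rightarrow> bool list set" where
  "MCSP s = {t. \<exists>m. length t = 2 ^ m \<and>
     (\<exists>B. wf_boolean_circuit m B \<and> real (boolean_size B) \<le> s (length t) \<and>
          (\<forall>x. length x = m \<longrightarrow> boolean_eval B x = truth_table_fun t x))}"

definition comparator_decides :: "comparator_circuit \<Rightarrow> nat \<Rightarrow> bool list set \<Rightarrow> bool" where
  "comparator_decides C n L \<longleftrightarrow>
     wf_comparator_circuit n C \<and> (\<forall>a. length a = n \<longrightarrow> comparator_eval C a = (a \<in> L))"

end

theory Submission
  imports Defs "HOL-Library.Multiset" "HOL-Library.FuncSet" "HOL-Real_Asymp.Real_Asymp"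
begin

text \<open>
  Cut the truth table into aligned blocks of \<open>k = n\<^sup>\<delta>\<close> positions and let \<open>C\<close> be a comparator circuit for
  \<open>MCSP[n\<^sup>\<alpha>]\<close> of the size in question. By averaging, at least half of the blocks label at most
  \<open>l = O(n\<^bsup>\<alpha>/2 - 3\<delta>\<^esup>)\<close> wires each. If the input is fixed outside such a block, then a gate on two
  comparable wire functions only permutes the wires, and a gate on two incomparable ones decreases
  the number of incomparable pairs. So at most \<open>l\<^sup>2\<close> gates matter, and \<open>C\<close> has only
  \<open>n\<^bsup>O(l\<^sup>2)\<^esup>\<close> residual functions on the block.

  Take \<open>c = O(1)\<close> random tables of \<open>R = l\<^sup>2 n\<^bsup>O(\<delta>)\<^esup>\<close> strings of length \<open>k\<close>. A moment bound shows that,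
  with positive probability, every residual function has nearly the same mean on the XORs of \<open>c\<close>
  table entries, one from each table, as on all strings. By a hybrid argument over
  \<open>T = n\<^bsup>\<alpha> - \<delta>/2\<^esup>\<close> light blocks, \<open>C\<close> cannot tell a string that is made of such XORs on these blocks
  and is zero elsewhere from one with uniform blocks. The former has circuits of size
  \<open>n\<^sup>\<alpha>\<close>: a lookup of \<open>c\<close> pointers per block, followed by a lookup in the tables. Hence \<open>C\<close> accepts at
  least half of the \<open>2\<^bsup>Tk\<^esup>\<close> latter ones, more than there are small circuits.
\<close>

section \<open>Comparisons in a lattice\<close>

text \<open>Padding with one extra letter turns the words of length at most \<open>N\<close> over
  \<open>q\<close> letters into words of length exactly \<open>N\<close>.\<close>

lemma sum_power_le: "(\<Sum>t\<le>N. q ^ t) \<le> (q + 1 :: nat) ^ N"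
proof (induction N)
  case (Suc N)
  have "q * q ^ N \<le> q * (q + 1) ^ N" by (intro mult_le_mono power_mono) auto
  from add_mono[OF Suc this] show ?case by simp
qed simp

section \<open>Incomparable pairs as a potential\<close>

definition incomparable :: "'b::lattice \<Rightarrow> 'b \<Rightarrow> bool" where
  "incomparable a b \<longleftrightarrow> \<not> a \<le> b \<and> \<not> b \<le> a"

lemma incomparable_sym: "incomparable a b \<longleftrightarrow> incomparable b a"
  by (auto simp: incomparable_def)

lemma incomparable_irrefl [simp]: "\<not> incomparable a a"
  by (auto simp: incomparable_def)

text \<open>An element comparable to one of \<open>a\<close> and \<open>b\<close> is comparable to
  the meet or to the join: above \<open>a\<close> it is above the meet, below \<open>a\<close> it is
  below the join. An element comparable to both lies above both or below both, since lying between
  them would make \<open>a\<close> and \<open>b\<close> comparable; so it is comparable to both meet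
  and join.\<close>

lemma incomparable_inf_sup:
  fixes a b c :: "'b::lattice"
  assumes "incomparable a b"
  shows "of_bool (incomparable (inf a b) c) + of_bool (incomparable (sup a b) c)
           \<le> (of_bool (incomparable a c) + of_bool (incomparable b c) :: nat)"
  using assms unfolding incomparable_def
  by (auto intro: le_infI1 le_infI2 le_supI1 le_supI2 dest: order_trans)

text \<open>The potential that bounds the number of effective gates. Ordered pairs are counted, so
  an unordered pair contributes 2.\<close>

definition incomparabilities :: "'b::lattice multiset \<Rightarrow> nat" where
  "incomparabilities M = (\<Sum>a\<in>#M. \<Sum>b\<in>#M. of_bool (incomparable a b))"

lemma incomparabilities_add2:
  "incomparabilities (add_mset a (add_mset b N)) =
     2 * of_bool (incomparable a b) +
     2 * (\<Sum>c\<in>#N. of_bool (incomparable a c) + of_bool (incomparable b c)) + incomparabilities N"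
proof -
  have "(\<Sum>c\<in>#N. of_bool (incomparable c x)) = (\<Sum>c\<in>#N. of_bool (incomparable x c) :: nat)" for x
    by (intro arg_cong[of _ _ sum_mset] image_mset_cong) (simp add: incomparable_sym)
  then show ?thesis
    by (simp add: incomparabilities_def sum_mset.distrib incomparable_sym[of b a])
qed

lemma incomparabilities_le: "incomparabilities M \<le> (size M)\<^sup>2"
proof -
  have "(\<Sum>b\<in>#M. of_bool (incomparable a b)) \<le> size M" for a
    using sum_mset_mono[of M "\<lambda>b. of_bool (incomparable a b)" "\<lambda>_. 1::nat"] by simp
  then have "incomparabilities M \<le> (\<Sum>a\<in>#M. size M)"
    unfolding incomparabilities_def by (intro sum_mset_mono)
  then show ?thesis by (simp add: power2_eq_square)
qed

text \<open>The possible effects of a gate on two incomparable values. The state is a multiset,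
  which forgets the wires, so that a gate on comparable values does not change it.\<close>

definition comparisons :: "'b::lattice multiset \<Rightarrow> 'b multiset set" where
  "comparisons M = (\<lambda>(a, b). M - {#a, b#} + {#inf a b, sup a b#}) `
     {(a, b). a \<in># M \<and> b \<in># M \<and> incomparable a b}"

lemma incomparable_split:
  assumes "a \<in># M" "b \<in># M" "incomparable a b"
  obtains N where "M = add_mset a (add_mset b N)"
proof -
  have "a \<noteq> b" using assms(3) by auto
  then obtain N where "M = add_mset a N" "b \<in># N"
    using assms by (metis insert_noteq_member mset_add)
  then show ?thesis using that by (metis mset_add)
qed

lemma comparisons_cases:
  assumes "M' \<in> comparisons M"
  obtains a b N where "incomparable a b" "M = add_mset a (add_mset b N)"
    "M' = add_mset (inf a b) (add_mset (sup a b) N)"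
proof -
  obtain a b where ab: "a \<in># M" "b \<in># M" "incomparable a b"
    and M': "M' = M - {#a, b#} + {#inf a b, sup a b#}"
    using assms by (auto simp: comparisons_def)
  obtain N where "M = add_mset a (add_mset b N)"
    using incomparable_split[OF ab] .
  then show ?thesis using that ab(3) M' by simp
qed

lemma comparisons_size: "M' \<in> comparisons M \<Longrightarrow> size M' = size M"
  by (erule comparisons_cases) simp

text \<open>The meet and the join are comparable, so the chosen pair itself no longer counts. By
  \<open>incomparable_inf_sup\<close>, the number of pairs with the remaining elements does not
  grow.\<close>

lemma comparisons_incomparabilities:
  assumes "M' \<in> comparisons M"
  shows "incomparabilities M' < incomparabilities M"
  using assms
proof (cases rule: comparisons_cases)
  case (1 a b N)
  have "(\<Sum>c\<in>#N. of_bool (incomparable (inf a b) c) + of_bool (incomparable (sup a b) c))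
    \<le> (\<Sum>c\<in>#N. of_bool (incomparable a c) + of_bool (incomparable b c) :: nat)"
    by (intro sum_mset_mono incomparable_inf_sup 1)
  moreover have "\<not> incomparable (inf a b) (sup a b)"
    by (auto simp: incomparable_def intro: le_infI1 le_supI1)
  ultimately show ?thesis using 1 by (simp add: incomparabilities_add2)
qed

lemma card_set_mset_le_size: "card (set_mset M) \<le> size M"
  by (metis card_length ex_mset set_mset_mset size_mset)

lemma comparisons_finite_card:
  "finite (comparisons M) \<and> card (comparisons M) \<le> (size M)\<^sup>2"
proof -
  let ?P = "{(a, b). a \<in># M \<and> b \<in># M \<and> incomparable a b}"
  have sub: "?P \<subseteq> set_mset M \<times> set_mset M" by auto
  have fin: "finite ?P" by (rule finite_subset[OF sub]) simp
  have "card (set_mset M) \<le> size M" by (rule card_set_mset_le_size)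
  then have "card ?P \<le> (size M)\<^sup>2"
    using card_mono[OF _ sub] by (auto simp: power2_eq_square card_cartesian_product
        intro: order_trans mult_le_mono)
  then show ?thesis
    using fin unfolding comparisons_def by (blast intro: order_trans[OF card_image_le])
qed

primrec comparison_reach :: "nat \<Rightarrow> 'b::lattice multiset \<Rightarrow> 'b multiset set" where
  "comparison_reach 0 M = {M}"
| "comparison_reach (Suc t) M = (\<Union>M' \<in> comparison_reach t M. comparisons M')"

lemma comparison_reach_size: "M' \<in> comparison_reach t M \<Longrightarrow> size M' = size M"
  by (induction t arbitrary: M') (auto dest: comparisons_size)

lemma comparison_reach_finite_card:
  "finite (comparison_reach t M) \<and> card (comparison_reach t M) \<le> ((size M)\<^sup>2) ^ t"
proof (induction t)
  case (Suc t)
  have "card (comparison_reach (Suc t) M) \<le> (\<Sum>M'\<in>comparison_reach t M. card (comparisons M'))"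
    using Suc by (simp add: card_UN_le)
  also have "\<dots> \<le> (\<Sum>M'\<in>comparison_reach t M. (size M)\<^sup>2)"
  proof (rule sum_mono)
    fix M' assume "M' \<in> comparison_reach t M"
    then show "card (comparisons M') \<le> (size M)\<^sup>2"
      using comparisons_finite_card[of M'] by (simp add: comparison_reach_size)
  qed
  also have "\<dots> \<le> ((size M)\<^sup>2) ^ Suc t" using Suc by simp
  finally show ?case using Suc comparisons_finite_card by auto
qed auto

text \<open>At most \<open>(size M)\<^sup>2\<close> comparisons are possible, since each of them
  decreases \<open>incomparabilities\<close>. The two constants account for wires that do not depend
  on the free part of the input.\<close>

definition comparator_outputs :: "'b::bounded_lattice multiset \<Rightarrow> 'b set" where
  "comparator_outputs M =
     {bot, top} \<union> (\<Union>t\<in>{..(size M)\<^sup>2}. \<Union>M'\<in>comparison_reach t M. set_mset M')"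

text \<open>After \<open>t\<close> comparisons there are at most \<open>q ^ t\<close> multisets,
  with \<open>size M \<le> q\<close> values each. Summing over \<open>t \<le> q\<close> and adding
  the two constants gives \<open>2 + (q + 1) ^ q * q\<close>.\<close>

lemma comparator_outputs_finite_card:
  fixes M :: "'b::bounded_lattice multiset"
  defines "q \<equiv> (size M)\<^sup>2"
  shows "finite (comparator_outputs M) \<and> card (comparator_outputs M) \<le> (q + 2) ^ (q + 1)"
proof -
  let ?A = "\<lambda>t. \<Union>M'\<in>comparison_reach t M. set_mset M'"
  have fin: "finite (?A t)" for t using comparison_reach_finite_card by auto
  have card_A: "card (?A t) \<le> q ^ t * size M" for t
  proof -
    have "card (?A t) \<le> (\<Sum>M'\<in>comparison_reach t M. card (set_mset M'))"
      using comparison_reach_finite_card by (intro card_UN_le) blast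
    also have "\<dots> \<le> (\<Sum>M'\<in>comparison_reach t M. size M)"
    proof (rule sum_mono)
      fix M' assume "M' \<in> comparison_reach t M"
      then show "card (set_mset M') \<le> size M"
        using card_set_mset_le_size[of M'] by (simp add: comparison_reach_size)
    qed
    also have "\<dots> \<le> q ^ t * size M"
      using comparison_reach_finite_card[of t M] by (simp add: q_def)
    finally show ?thesis .
  qed
  have "card (\<Union>t\<in>{..q}. ?A t) \<le> (\<Sum>t\<le>q. card (?A t))"
    by (rule card_UN_le) simp
  also have "\<dots> \<le> (\<Sum>t\<le>q. q ^ t * size M)" by (intro sum_mono card_A)
  also have "\<dots> \<le> (q + 1) ^ q * q"
    using sum_power_le[of q q] by (simp add: sum_distrib_right[symmetric] q_def power2_eq_square
        mult_le_mono)
  finally have "card (comparator_outputs M) \<le> 2 + (q + 1) ^ q * q"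
    unfolding comparator_outputs_def q_def[symmetric]
    using card_Un_le[of "{bot, top}" "\<Union>t\<in>{..q}. ?A t"] card_insert_le_m1[of 2 "{top}" bot]
    by (simp add: card_insert_if split: if_splits)
  also have "\<dots> \<le> (q + 2) ^ q * (q + 2)"
  proof -
    have "(q + 1) ^ q * q \<le> (q + 2) ^ q * q" by (intro mult_le_mono power_mono) auto
    moreover have "2 \<le> (q + 2) ^ q * 2" by simp
    ultimately show ?thesis unfolding distrib_left by linarith
  qed
  finally show ?thesis using fin by (simp add: comparator_outputs_def mult.commute)
qed

section \<open>Gates acting on wire functions\<close>

fun function_gate :: "nat \<times> nat \<Rightarrow> (nat \<Rightarrow> 'b::lattice) \<Rightarrow> nat \<Rightarrow> 'b" where
  "function_gate (i, j) G = G(i := inf (G i) (G j), j := sup (G i) (G j))"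

lemma image_mset_function_gate:
  assumes "finite A" "i \<in> A" "j \<in> A" "i \<noteq> j"
  obtains N where "image_mset G (mset_set A) = add_mset (G i) (add_mset (G j) N)"
    "image_mset (function_gate (i, j) G) (mset_set A) =
       add_mset (inf (G i) (G j)) (add_mset (sup (G i) (G j)) N)"
proof -
  let ?B = "A - {i} - {j}"
  have fin: "finite ?B" using assms by simp
  have *: "mset_set A = add_mset i (add_mset j (mset_set ?B))"
    using assms mset_set.remove[of A i] mset_set.remove[of "A - {i}" j] by simp
  have "image_mset (function_gate (i, j) G) (mset_set ?B) = image_mset G (mset_set ?B)"
    using fin by (intro image_mset_cong) auto
  then show ?thesis using that[of "image_mset G (mset_set ?B)"] * assms by simp
qed

text \<open>The invariant splits the wire values into a multiset \<open>M\<close> reached from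
  \<open>M0\<close> and constants \<open>N\<close>. A gate on comparable values only permutes the
  wires. Constants are comparable to everything, so both inputs of any other gate lie in
  \<open>M\<close>, and the gate is one more comparison, paid for by the potential.\<close>

lemma function_gate_reach:
  fixes G :: "nat \<Rightarrow> 'b::bounded_lattice"
  assumes "finite A" "\<forall>(i, j)\<in>set gs. i \<in> A \<and> j \<in> A \<and> i \<noteq> j"
    and "image_mset G (mset_set A) = M0 + N0" "set_mset N0 \<subseteq> {bot, top}"
  shows "\<exists>t M N. M \<in> comparison_reach t M0 \<and> t + incomparabilities M \<le> incomparabilities M0 \<and>
    set_mset N \<subseteq> {bot, top} \<and> image_mset (fold function_gate gs G) (mset_set A) = M + N"
  using assms(2)
proof (induction gs rule: rev_induct)
  case Nil
  show ?case using assms by (intro exI[of _ 0] exI[of _ M0] exI[of _ N0]) auto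
next
  case (snoc g gs)
  obtain i j where g: "g = (i, j)" by force
  define G' where "G' = fold function_gate gs G"
  obtain t M N where I: "M \<in> comparison_reach t M0" "t + incomparabilities M \<le> incomparabilities M0"
    "set_mset N \<subseteq> {bot, top}" "image_mset G' (mset_set A) = M + N"
    using snoc unfolding G'_def by auto
  have ij: "i \<in> A" "j \<in> A" "i \<noteq> j" using snoc.prems g by auto
  obtain K where K: "image_mset G' (mset_set A) = add_mset (G' i) (add_mset (G' j) K)"
    "image_mset (function_gate (i, j) G') (mset_set A) =
       add_mset (inf (G' i) (G' j)) (add_mset (sup (G' i) (G' j)) K)"
    using image_mset_function_gate[OF assms(1) ij] by blast
  have fold: "fold function_gate (gs @ [g]) G = function_gate (i, j) G'"
    by (simp add: G'_def g)
  show ?case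
  proof (cases "incomparable (G' i) (G' j)")
    case False
    then have "image_mset (function_gate (i, j) G') (mset_set A) = image_mset G' (mset_set A)"
      unfolding K by (auto simp: incomparable_def inf_absorb1 inf_absorb2 sup_absorb1 sup_absorb2)
    then show ?thesis unfolding fold using I by metis
  next
    case True
    have nt: "a \<notin># N" if "incomparable a b \<or> incomparable b a" for a b
      using that I(3) by (auto simp: incomparable_def)
    have "G' i \<in># M + N" "G' j \<in># M + N"
      unfolding I(4)[symmetric] K by auto
    then have "G' i \<in># M" "G' j \<in># M" using nt True by auto
    then obtain M' where M': "M = add_mset (G' i) (add_mset (G' j) M')"
      using True by (rule incomparable_split)
    let ?M = "add_mset (inf (G' i) (G' j)) (add_mset (sup (G' i) (G' j)) M')"
    have K': "K = M' + N" using I(4) K M' by simp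
    have mem: "?M \<in> comparisons M" unfolding comparisons_def
      using True M' by (intro image_eqI[of _ _ "(G' i, G' j)"]) auto
    then have "?M \<in> comparison_reach (Suc t) M0" using I(1) by auto
    moreover have "Suc t + incomparabilities ?M \<le> incomparabilities M0"
      using comparisons_incomparabilities[OF mem] I(2) by simp
    ultimately show ?thesis unfolding fold K K' using I(3)
      by (intro exI[of _ "Suc t"] exI[of _ ?M] exI[of _ N]) auto
  qed
qed

lemma function_gates_output:
  fixes G :: "nat \<Rightarrow> 'b::bounded_lattice"
  assumes "finite A" "\<forall>(i, j)\<in>set gs. i \<in> A \<and> j \<in> A \<and> i \<noteq> j"
    and "image_mset G (mset_set A) = M + N" "set_mset N \<subseteq> {bot, top}" "i \<in> A"
  shows "fold function_gate gs G i \<in> comparator_outputs M"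
proof -
  obtain t M' N' where I: "M' \<in> comparison_reach t M" "t + incomparabilities M' \<le> incomparabilities M"
    "set_mset N' \<subseteq> {bot, top}" "image_mset (fold function_gate gs G) (mset_set A) = M' + N'"
    using function_gate_reach[OF assms(1-4)] by blast
  have "fold function_gate gs G i \<in># M' + N'"
    unfolding I(4)[symmetric] using assms(1,5) by simp
  moreover have "t \<le> (size M)\<^sup>2" using I(2) incomparabilities_le[of M] by simp
  ultimately show ?thesis using I(1,3) unfolding comparator_outputs_def by auto
qed

text \<open>Meets and joins of predicates are pointwise, so evaluation at \<open>x\<close> commutes
  with every gate.\<close>

lemma fold_cgate_step_eq_function_gate:
  assumes "\<forall>(i, j)\<in>set gs. i < length w \<and> j < length w \<and> i \<noteq> j"
    and "\<forall>i<length w. w ! i = G i x" "i < length w"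
  shows "fold cgate_step gs w ! i = fold function_gate gs G i x"
  using assms
proof (induction gs arbitrary: w G)
  case (Cons g gs)
  obtain a b where g: "g = (a, b)" by force
  have "fold cgate_step gs (cgate_step g w) ! i = fold function_gate gs (function_gate g G) i x"
    using Cons.prems g
    by (intro Cons.IH) (auto simp: cgate_step_def nth_list_update)
  then show ?case by simp
qed simp

section \<open>Sampling by XORs of table entries\<close>

lemma sum_PiE_insert:
  assumes "x \<notin> S"
  shows "(\<Sum>g\<in>PiE (insert x S) T. F g) = (\<Sum>h\<in>T x. \<Sum>g\<in>PiE S T. F (g(x := h)))"
  using inj_combinator[OF assms, of T]
  by (simp add: PiE_insert_eq sum.reindex sum.cartesian_product case_prod_unfold)

text \<open>No position has a value of its own. In the expansion of a power of a sum over random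
  tables, only terms whose pointers into every table form such a pattern survive.\<close>

definition repeating :: "nat \<Rightarrow> nat \<Rightarrow> (nat \<Rightarrow> nat) set" where
  "repeating N R = {g \<in> {..<N} \<rightarrow>\<^sub>E {..<R}. \<forall>i<N. \<exists>i'<N. i' \<noteq> i \<and> g i' = g i}"

text \<open>Every nonempty fibre has at least two points.\<close>

lemma repeating_image_card:
  assumes "g \<in> repeating N R"
  shows "2 * card (g ` {..<N}) \<le> N"
proof -
  have "2 \<le> (\<Sum>i\<in>{i \<in> {..<N}. g i = y}. 1::nat)" if "y \<in> g ` {..<N}" for y
  proof -
    obtain i where i: "i < N" "y = g i" using \<open>y \<in> _\<close> by auto
    then obtain i' where "i' < N" "i' \<noteq> i" "g i' = g i"
      using assms by (auto simp: repeating_def)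
    then have "card {i, i'} \<le> card {i \<in> {..<N}. g i = y}"
      using i by (intro card_mono) auto
    then show ?thesis using \<open>i' \<noteq> i\<close> by simp
  qed
  then have "(\<Sum>y\<in>g ` {..<N}. 2) \<le> (\<Sum>y\<in>g ` {..<N}. \<Sum>i\<in>{i \<in> {..<N}. g i = y}. 1::nat)"
    by (intro sum_mono)
  also have "\<dots> = (\<Sum>i<N. 1)" by (rule sum.image_gen[symmetric]) simp
  finally show ?thesis by simp
qed

text \<open>A repeating function is determined by its values on \<open>p\<close> positions that include one
  representative of each value, and by the choice of a representative for every other position.\<close>

lemma repeating_finite_card:
  "finite (repeating (2 * p) R) \<and> card (repeating (2 * p) R) \<le> (4 * p * R) ^ p"
proof -
  let ?J = "{..<2 * p}"
  \<comment> \<open>The pair holds the values on \<open>I\<close> and a map that sends every other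
    position to a position in \<open>I\<close> with the same value.\<close>
  define merge :: "nat set \<Rightarrow> (nat \<Rightarrow> nat) \<times> (nat \<Rightarrow> nat) \<Rightarrow> nat \<Rightarrow> nat" where
    "merge I ab = (\<lambda>i\<in>?J. if i \<in> I then fst ab i else fst ab (snd ab i))" for I ab
  let ?D = "\<lambda>I. (I \<rightarrow>\<^sub>E {..<R}) \<times> ((?J - I) \<rightarrow>\<^sub>E I)"
  let ?S = "{I. I \<subseteq> ?J \<and> card I = p}"
  have finS: "finite ?S" by (rule finite_subset[of _ "Pow ?J"]) auto
  have cardS: "card ?S \<le> 4 ^ p"
    using n_subsets[of ?J p] binomial_le_pow2[of "2 * p" p] by (simp add: power_mult)
  have finI: "finite I" "card (?J - I) = p" if "I \<in> ?S" for I
    using that by (auto simp: card_Diff_subset finite_subset[of I ?J])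
  have finD: "finite (merge I ` ?D I)" if "I \<in> ?S" for I
    using finI[OF that] by (intro finite_imageI finite_cartesian_product finite_PiE) auto
  have cardD: "card (merge I ` ?D I) \<le> R ^ p * p ^ p" if "I \<in> ?S" for I
  proof -
    have "card (merge I ` ?D I) \<le> card (?D I)"
      using finI[OF that] by (intro card_image_le finite_cartesian_product finite_PiE) auto
    also have "\<dots> = R ^ p * p ^ p"
      using that finI[OF that] by (simp add: card_cartesian_product card_PiE)
    finally show ?thesis .
  qed
  have sub: "repeating (2 * p) R \<subseteq> (\<Union>I\<in>?S. merge I ` ?D I)"
  proof
    fix g assume g: "g \<in> repeating (2 * p) R"
    then have gE: "g \<in> ?J \<rightarrow>\<^sub>E {..<R}" by (simp add: repeating_def)
    obtain I0 where I0: "I0 \<subseteq> ?J" "inj_on g I0" "g ` ?J = g ` I0"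
      using subset_image_inj[of "g ` ?J" g ?J] by auto
    have "card I0 \<le> p" using repeating_image_card[OF g] I0 by (simp add: card_image)
    then obtain I where I: "I0 \<subseteq> I" "I \<subseteq> ?J" "card I = p"
      using exists_subset_between[of I0 p ?J] I0(1) by auto
    have "\<exists>i'\<in>I. g i' = g i" if "i \<in> ?J" for i
      using that I0(3) I(1) by (metis image_eqI image_iff subsetD)
    then obtain b where b: "\<And>i. i \<in> ?J \<Longrightarrow> b i \<in> I \<and> g (b i) = g i" by metis
    have "g = merge I (restrict g I, restrict b (?J - I))"
    proof (rule extensionalityI[of _ ?J])
      fix i assume "i \<in> ?J"
      then show "g i = merge I (restrict g I, restrict b (?J - I)) i"
        using b by (simp add: merge_def)
    qed (use gE in \<open>auto simp: merge_def PiE_def\<close>)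
    moreover have "(restrict g I, restrict b (?J - I)) \<in> ?D I"
      using gE I(2) b by auto
    ultimately show "g \<in> (\<Union>I\<in>?S. merge I ` ?D I)" using I by blast
  qed
  have "card (repeating (2 * p) R) \<le> card (\<Union>I\<in>?S. merge I ` ?D I)"
    using sub finS finD by (intro card_mono) auto
  also have "\<dots> \<le> (\<Sum>I\<in>?S. card (merge I ` ?D I))" by (rule card_UN_le[OF finS])
  also have "\<dots> \<le> card ?S * (R ^ p * p ^ p)"
    using sum_bounded_above[of ?S "\<lambda>I. card (merge I ` ?D I)" "R ^ p * p ^ p"] cardD by simp
  also have "\<dots> \<le> 4 ^ p * (R ^ p * p ^ p)" using cardS by (rule mult_le_mono1)
  finally have "card (repeating (2 * p) R) \<le> (4 * p * R) ^ p"
    by (simp add: power_mult_distrib mult_ac)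
  moreover have "finite (repeating (2 * p) R)"
    using finite_subset[OF sub] finS finD by auto
  ultimately show ?thesis by simp
qed

section \<open>XORs of table entries, with strings encoded as sets of positions\<close>

definition table_xor :: "nat \<Rightarrow> (nat \<times> nat \<Rightarrow> 'a set) \<Rightarrow> (nat \<Rightarrow> nat) \<Rightarrow> 'a set" where
  "table_xor c X z = {v. odd (card {j. j < c \<and> v \<in> X (j, z j)})}"

abbreviation xor_tables :: "nat \<Rightarrow> nat \<Rightarrow> 'a set \<Rightarrow> (nat \<times> nat \<Rightarrow> 'a set) set" where
  "xor_tables c R K \<equiv> ({..<c} \<times> {..<R}) \<rightarrow>\<^sub>E Pow K"

lemma table_xor_cong:
  assumes "\<And>j. j < c \<Longrightarrow> X (j, z j) = X' (j, z' j)"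
  shows "table_xor c X z = table_xor c X' z'"
proof -
  have "{j. j < c \<and> v \<in> X (j, z j)} = {j. j < c \<and> v \<in> X' (j, z' j)}" for v
    using assms by auto
  then show ?thesis by (simp add: table_xor_def)
qed

lemma odd_card_Collect:
  assumes "odd (card {j. P j})"
  shows "\<exists>j. P j"
proof (rule ccontr)
  assume "\<nexists>j. P j"
  then have "{j. P j} = {}" by auto
  then show False using assms by simp
qed

lemma table_xor_subset:
  assumes "X \<in> xor_tables c R K" "z \<in> {..<c} \<rightarrow>\<^sub>E {..<R}"
  shows "table_xor c X z \<subseteq> K"
proof
  fix v assume "v \<in> table_xor c X z"
  then obtain j where "j < c" "v \<in> X (j, z j)"
    unfolding table_xor_def by (auto dest: odd_card_Collect)
  then show "v \<in> K" using assms by (auto simp: PiE_iff)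
qed

text \<open>XOR with a fixed \<open>D\<close> is an involution of \<open>Pow K\<close>.\<close>

lemma sum_Pow_sym_diff:
  fixes \<phi> :: "'a set \<Rightarrow> real"
  assumes "D \<subseteq> K"
  shows "(\<Sum>h\<in>Pow K. \<phi> (sym_diff h D)) = (\<Sum>h\<in>Pow K. \<phi> h)"
  by (rule sum.reindex_bij_witness[of _ "\<lambda>h. sym_diff h D" "\<lambda>h. sym_diff h D"])
    (use assms in auto)

text \<open>The entry of table \<open>j\<close> at \<open>zs i0 j\<close> is read by factor
  \<open>i0\<close> only. With all other entries fixed, summing over this entry runs the argument of
  factor \<open>i0\<close> through all of \<open>Pow K\<close>, where \<open>\<phi>\<close> sums to
  zero, while the other factors stay constant.\<close>

lemma table_xor_sum_eq_0:
  fixes \<phi> :: "'a set \<Rightarrow> real" and N :: nat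
  assumes "finite K" "(\<Sum>h\<in>Pow K. \<phi> h) = 0"
    and zs: "\<And>i. i < N \<Longrightarrow> zs i \<in> {..<c} \<rightarrow>\<^sub>E {..<R}"
    and "i0 < N" "j < c" and uniq: "\<And>i. i < N \<Longrightarrow> i \<noteq> i0 \<Longrightarrow> zs i j \<noteq> zs i0 j"
  shows "(\<Sum>X\<in>xor_tables c R K. \<Prod>i<N. \<phi> (table_xor c X (zs i))) = 0"
proof -
  let ?e = "(j, zs i0 j)"
  let ?E = "{..<c} \<times> {..<R} - {?e}"
  have "zs i0 j < R" using zs[OF \<open>i0 < N\<close>] \<open>j < c\<close> by (auto simp: PiE_iff)
  then have E: "{..<c} \<times> {..<R} = insert ?e ?E" using \<open>j < c\<close> by auto
  have 0: "(\<Sum>h\<in>Pow K. \<Prod>i<N. \<phi> (table_xor c (Y(?e := h)) (zs i))) = 0"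
    if Y: "Y \<in> ?E \<rightarrow>\<^sub>E Pow K" for Y
  proof -
    \<comment> \<open>\<open>D\<close> is the XOR of the other entries that factor \<open>i0\<close>
      reads; it shifts the free entry \<open>h\<close>.\<close>
    define D where "D = {v. odd (card {j'. j' < c \<and> j' \<noteq> j \<and> v \<in> Y (j', zs i0 j')})}"
    have "D \<subseteq> K"
    proof
      fix v assume "v \<in> D"
      then obtain j' where "j' < c" "j' \<noteq> j" "v \<in> Y (j', zs i0 j')"
        unfolding D_def by (auto dest: odd_card_Collect)
      moreover have "zs i0 j' < R" using zs[OF \<open>i0 < N\<close>] \<open>j' < c\<close> by (auto simp: PiE_iff)
      ultimately show "v \<in> K" using Y by (auto simp: PiE_iff)
    qed
    have eq: "table_xor c (Y(?e := h)) (zs i0) = sym_diff h D" for h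
    proof -
      have "{j'. j' < c \<and> v \<in> (Y(?e := h)) (j', zs i0 j')} =
        (if v \<in> h then insert j else id) {j'. j' < c \<and> j' \<noteq> j \<and> v \<in> Y (j', zs i0 j')}" for v
        using \<open>j < c\<close> by auto
      then show ?thesis unfolding table_xor_def D_def by auto
    qed
    have neq: "table_xor c (Y(?e := h)) (zs i) = table_xor c Y (zs i)" if "i < N" "i \<noteq> i0" for h i
      using uniq[OF that] by (intro table_xor_cong) auto
    have "(\<Prod>i<N. \<phi> (table_xor c (Y(?e := h)) (zs i))) =
        \<phi> (sym_diff h D) * (\<Prod>i\<in>{..<N} - {i0}. \<phi> (table_xor c Y (zs i)))" for h
      using \<open>i0 < N\<close> by (subst prod.remove[of _ i0]) (auto simp: eq neq)
    then show ?thesis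
      using sum_Pow_sym_diff[OF \<open>D \<subseteq> K\<close>, of \<phi>] assms(2)
      by (simp add: sum_distrib_right[symmetric])
  qed
  have "(\<Sum>X\<in>xor_tables c R K. \<Prod>i<N. \<phi> (table_xor c X (zs i))) =
    (\<Sum>Y\<in>?E \<rightarrow>\<^sub>E Pow K. \<Sum>h\<in>Pow K. \<Prod>i<N. \<phi> (table_xor c (Y(?e := h)) (zs i)))"
    by (subst E, subst sum_PiE_insert, simp) (rule sum.swap)
  also have "\<dots> = 0" by (intro sum.neutral ballI 0)
  finally show ?thesis .
qed

text \<open>The power expands into a sum over sequences of \<open>2 * p\<close> pointer tuples. If
  the pointers into some table do not form a \<open>repeating\<close> pattern, the term vanishes by
  \<open>table_xor_sum_eq_0\<close>. Every other term is at most the number of table choices, and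
  \<open>repeating_finite_card\<close>, applied to each of the \<open>c\<close> tables, bounds the
  number of these terms.\<close>

lemma table_xor_moment:
  fixes \<phi> :: "'a set \<Rightarrow> real"
  assumes K: "finite K" and \<phi>0: "(\<Sum>h\<in>Pow K. \<phi> h) = 0"
    and \<phi>1: "\<And>h. h \<in> Pow K \<Longrightarrow> \<bar>\<phi> h\<bar> \<le> 1"
  shows "(\<Sum>X\<in>xor_tables c R K. (\<Sum>z\<in>{..<c} \<rightarrow>\<^sub>E {..<R}. \<phi> (table_xor c X z)) ^ (2 * p))
    \<le> card (xor_tables c R K) * (4 * real p * real R) ^ (p * c)"
proof -
  let ?Z = "{..<c} \<rightarrow>\<^sub>E {..<R}" and ?J = "{..<2 * p}" and ?Xs = "xor_tables c R K"
  define B where "B = {zs \<in> ?J \<rightarrow>\<^sub>E ?Z. \<forall>j<c. (\<lambda>i\<in>?J. zs i j) \<in> repeating (2 * p) R}"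
  have finZ: "finite ?Z" by (intro finite_PiE) auto
  have finJ: "finite (?J \<rightarrow>\<^sub>E ?Z)" using finZ by (intro finite_PiE) auto
  have cardB: "card B \<le> ((4 * p * R) ^ p) ^ c"
  proof -
    let ?t = "\<lambda>zs. \<lambda>j\<in>{..<c}. \<lambda>i\<in>?J. zs i j"
    have "inj_on ?t B"
    proof (rule inj_onI)
      fix zs zs' assume zs: "zs \<in> B" "zs' \<in> B" "?t zs = ?t zs'"
      have eq: "zs i j = zs' i j" if "i \<in> ?J" "j \<in> {..<c}" for i j
        using fun_cong[OF fun_cong[OF zs(3), of j], of i] that by simp
      have mem: "zs i \<in> ?Z" "zs' i \<in> ?Z" if "i \<in> ?J" for i
        using zs that by (auto simp: B_def)
      have "zs i = zs' i" if "i \<in> ?J" for i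
        using eq[OF that] mem[OF that] by (intro PiE_ext[of _ "{..<c}"]) auto
      then show "zs = zs'"
        using zs(1,2) by (intro PiE_ext[of zs ?J "\<lambda>_. ?Z" zs']) (simp_all add: B_def)
    qed
    moreover have "?t ` B \<subseteq> {..<c} \<rightarrow>\<^sub>E repeating (2 * p) R" by (auto simp: B_def)
    ultimately have "card B \<le> card ({..<c} \<rightarrow>\<^sub>E repeating (2 * p) R)"
      using repeating_finite_card[of p R]
      by (intro card_inj_on_le[of ?t] finite_PiE) auto
    also have "\<dots> \<le> ((4 * p * R) ^ p) ^ c"
      using repeating_finite_card[of p R] by (simp add: card_PiE power_mono)
    finally show ?thesis .
  qed
  have bound: "(\<Sum>X\<in>?Xs. \<Prod>i\<in>?J. \<phi> (table_xor c X (zs i))) \<le> (if zs \<in> B then real (card ?Xs) else 0)"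
    if zs: "zs \<in> ?J \<rightarrow>\<^sub>E ?Z" for zs
  proof (cases "zs \<in> B")
    case True
    have "(\<Prod>i\<in>?J. \<phi> (table_xor c X (zs i))) \<le> 1" if X: "X \<in> ?Xs" for X
    proof -
      have "\<bar>\<Prod>i\<in>?J. \<phi> (table_xor c X (zs i))\<bar> \<le> 1"
        unfolding abs_prod
        using zs table_xor_subset[OF X] by (intro prod_le_1) (auto simp: PiE_iff intro!: \<phi>1)
      then show ?thesis by simp
    qed
    then show ?thesis using True sum_mono[of ?Xs _ "\<lambda>_. 1::real"] by simp
  next
    case False
    then obtain j where j: "j < c" "(\<lambda>i\<in>?J. zs i j) \<notin> repeating (2 * p) R"
      using zs by (auto simp: B_def)
    moreover have "(\<lambda>i\<in>?J. zs i j) \<in> ?J \<rightarrow>\<^sub>E {..<R}" using zs j(1) by (auto simp: PiE_iff)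
    ultimately obtain i0 where "i0 < 2 * p" "\<And>i. i < 2 * p \<Longrightarrow> i \<noteq> i0 \<Longrightarrow> zs i j \<noteq> zs i0 j"
      by (auto simp: repeating_def)
    then have "(\<Sum>X\<in>?Xs. \<Prod>i\<in>?J. \<phi> (table_xor c X (zs i))) = 0"
      using zs j(1) by (intro table_xor_sum_eq_0[OF K \<phi>0, of _ zs _ _ i0 j]) auto
    then show ?thesis using False by simp
  qed
  have "(\<Sum>X\<in>?Xs. (\<Sum>z\<in>?Z. \<phi> (table_xor c X z)) ^ (2 * p)) =
    (\<Sum>X\<in>?Xs. \<Sum>zs\<in>?J \<rightarrow>\<^sub>E ?Z. \<Prod>i\<in>?J. \<phi> (table_xor c X (zs i)))"
    using finZ prod_sum_PiE[of ?J "\<lambda>_. ?Z" "\<lambda>_ z. \<phi> (table_xor c X z)" for X] by simp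
  also have "\<dots> = (\<Sum>zs\<in>?J \<rightarrow>\<^sub>E ?Z. \<Sum>X\<in>?Xs. \<Prod>i\<in>?J. \<phi> (table_xor c X (zs i)))"
    by (rule sum.swap)
  also have "\<dots> \<le> (\<Sum>zs\<in>?J \<rightarrow>\<^sub>E ?Z. if zs \<in> B then real (card ?Xs) else 0)"
    by (intro sum_mono bound)
  also have "\<dots> = real (card B) * card ?Xs"
    using finJ by (subst sum.inter_restrict[symmetric]) (auto simp: B_def Int_def)
  also have "\<dots> \<le> real (((4 * p * R) ^ p) ^ c) * card ?Xs"
    by (intro mult_right_mono of_nat_mono cardB) simp
  also have "\<dots> = card ?Xs * (4 * real p * real R) ^ (p * c)"
    by (subst mult.commute) (simp add: power_mult)
  finally show ?thesis .
qed

text \<open>Markov's inequality for the moment of order \<open>2 * p\<close>. The even exponent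
  makes the discarded terms nonnegative.\<close>

lemma table_xor_deviation:
  fixes \<phi> :: "'a set \<Rightarrow> real" and r :: real
  assumes K: "finite K" and \<phi>0: "(\<Sum>h\<in>Pow K. \<phi> h) = 0"
    and \<phi>1: "\<And>h. h \<in> Pow K \<Longrightarrow> \<bar>\<phi> h\<bar> \<le> 1" and "0 \<le> r"
  shows "card {X \<in> xor_tables c R K. r \<le> (\<Sum>z\<in>{..<c} \<rightarrow>\<^sub>E {..<R}. \<phi> (table_xor c X z))} * r ^ (2 * p)
    \<le> card (xor_tables c R K) * (4 * real p * real R) ^ (p * c)"
proof -
  let ?Xs = "xor_tables c R K"
  let ?s = "\<lambda>X. \<Sum>z\<in>{..<c} \<rightarrow>\<^sub>E {..<R}. \<phi> (table_xor c X z)"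
  have fin: "finite ?Xs" using K by (intro finite_PiE) auto
  have "card {X \<in> ?Xs. r \<le> ?s X} * r ^ (2 * p) = (\<Sum>X\<in>{X \<in> ?Xs. r \<le> ?s X}. r ^ (2 * p))" by simp
  also have "\<dots> \<le> (\<Sum>X\<in>{X \<in> ?Xs. r \<le> ?s X}. ?s X ^ (2 * p))"
    using \<open>0 \<le> r\<close> by (intro sum_mono power_mono) auto
  also have "\<dots> \<le> (\<Sum>X\<in>?Xs. ?s X ^ (2 * p))"
    using fin by (intro sum_mono2) (auto simp: power_mult)
  also have "\<dots> \<le> card ?Xs * (4 * real p * real R) ^ (p * c)"
    using table_xor_moment[OF K \<phi>0 \<phi>1] by simp
  finally show ?thesis .
qed

definition average :: "'a set \<Rightarrow> ('a \<Rightarrow> real) \<Rightarrow> real" where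
  "average A f = (\<Sum>a\<in>A. f a) / card A"

text \<open>A union bound over \<open>F\<close>: by \<open>small\<close>, the fractions of tables
  that are bad for some \<open>f\<close> add up to less than 1. Only deviations upwards are
  excluded, which is the direction the hybrid argument uses.\<close>

lemma table_xor_sampler:
  fixes F :: "('a set \<Rightarrow> bool) set"
  assumes K: "finite K" and F: "finite F" and "0 < \<eta>"
    and small: "card F * (4 * real p * real R) ^ (p * c) < (\<eta> * real R ^ c) ^ (2 * p)"
  obtains X where "X \<in> xor_tables c R K"
    "\<And>f. f \<in> F \<Longrightarrow> average ({..<c} \<rightarrow>\<^sub>E {..<R}) (\<lambda>z. of_bool (f (table_xor c X z)))
        \<le> average (Pow K) (\<lambda>h. of_bool (f h)) + \<eta>"
proof -
  let ?Xs = "xor_tables c R K" and ?Z = "{..<c} \<rightarrow>\<^sub>E {..<R}"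
  define \<mu> where "\<mu> f = average (Pow K) (\<lambda>h. of_bool (f h))" for f
  \<comment> \<open>The indicator of \<open>f\<close>, centred to have mean zero on all strings, as
    the moment bound requires.\<close>
  define \<phi> where "\<phi> f h = of_bool (f h) - \<mu> f" for f h
  let ?r = "\<eta> * real R ^ c"
  define bad where "bad f = {X \<in> ?Xs. ?r \<le> (\<Sum>z\<in>?Z. \<phi> f (table_xor c X z))}" for f
  have cardZ: "real (card ?Z) = real R ^ c" by (simp add: card_PiE)
  have fin: "finite ?Xs" using K by (intro finite_PiE) auto
  have "?Xs \<noteq> {}" by (auto simp: PiE_eq_empty_iff)
  then have pos: "0 < card ?Xs" using fin by (simp add: card_gt_0_iff)
  have cardH: "0 < card (Pow K)" using K by (simp add: card_Pow)
  have \<mu>: "0 \<le> \<mu> f" "\<mu> f \<le> 1" for f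
  proof -
    have "(\<Sum>h\<in>Pow K. of_bool (f h)) \<le> (\<Sum>h\<in>Pow K. 1::real)" by (intro sum_mono) auto
    then show "\<mu> f \<le> 1" using cardH by (simp add: \<mu>_def average_def)
    show "0 \<le> \<mu> f" by (simp add: \<mu>_def average_def sum_nonneg)
  qed
  have \<phi>0: "(\<Sum>h\<in>Pow K. \<phi> f h) = 0" for f
    using cardH by (simp add: \<phi>_def sum_subtractf \<mu>_def average_def)
  have \<phi>1: "\<bar>\<phi> f h\<bar> \<le> 1" for f h using \<mu>[of f] by (auto simp: \<phi>_def)
  have bad: "card (bad f) * ?r ^ (2 * p) \<le> card ?Xs * (4 * real p * real R) ^ (p * c)" for f
    using table_xor_deviation[OF K \<phi>0[of f] \<phi>1, of ?r c R p] \<open>0 < \<eta>\<close>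
    unfolding bad_def by simp
  have fin_bad: "finite (bad f)" for f using fin by (simp add: bad_def)
  have "\<not> ?Xs \<subseteq> (\<Union>f\<in>F. bad f)"
  proof
    assume "?Xs \<subseteq> (\<Union>f\<in>F. bad f)"
    then have "card ?Xs \<le> card (\<Union>f\<in>F. bad f)"
      using fin_bad F by (intro card_mono) auto
    then have "card ?Xs \<le> (\<Sum>f\<in>F. card (bad f))"
      using card_UN_le[OF F, of bad] by (rule order_trans)
    then have "card ?Xs * ?r ^ (2 * p) \<le> (\<Sum>f\<in>F. real (card (bad f))) * ?r ^ (2 * p)"
      using \<open>0 < \<eta>\<close> by (intro mult_right_mono) (simp_all flip: of_nat_sum)
    also have "\<dots> = (\<Sum>f\<in>F. card (bad f) * ?r ^ (2 * p))" by (simp add: sum_distrib_right)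
    also have "\<dots> \<le> (\<Sum>f\<in>F. card ?Xs * (4 * real p * real R) ^ (p * c))"
      by (intro sum_mono bad)
    also have "\<dots> = card ?Xs * (card F * (4 * real p * real R) ^ (p * c))" by simp
    also have "\<dots> < card ?Xs * ?r ^ (2 * p)"
      using small pos by (intro mult_strict_left_mono) auto
    finally show False by simp
  qed
  then obtain X where X: "X \<in> ?Xs" "\<And>f. f \<in> F \<Longrightarrow> X \<notin> bad f" by blast
  have "average ?Z (\<lambda>z. of_bool (f (table_xor c X z))) \<le> \<mu> f + \<eta>" if "f \<in> F" for f
  proof (cases "card ?Z = 0")
    \<comment> \<open>There are no pointer tuples, and an average over the empty set is 0 because
      division by zero gives 0.\<close>
    case True
    then show ?thesis using \<mu>(1)[of f] \<open>0 < \<eta>\<close> by (simp add: average_def)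
  next
    case False
    have "(\<Sum>z\<in>?Z. of_bool (f (table_xor c X z))) - card ?Z * \<mu> f \<le> card ?Z * \<eta>"
      using X(2)[OF that] X(1) cardZ by (simp add: bad_def \<phi>_def sum_subtractf mult.commute)
    then show ?thesis using False
      by (simp add: average_def pos_divide_le_eq algebra_simps del: sum_of_bool_eq)
  qed
  then show ?thesis using that X(1) unfolding \<mu>_def by blast
qed

section \<open>Averages over products and the hybrid argument\<close>

lemma average_mono: "(\<And>a. a \<in> A \<Longrightarrow> f a \<le> g a) \<Longrightarrow> average A f \<le> average A g"
  by (simp add: average_def divide_right_mono sum_mono)

lemma average_add_const:
  "finite A \<Longrightarrow> A \<noteq> {} \<Longrightarrow> average A (\<lambda>a. f a + b) = average A f + b"
  by (simp add: average_def sum.distrib add_divide_distrib)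

lemma average_swap: "average A (\<lambda>a. average B (f a)) = average B (\<lambda>b. average A (\<lambda>a. f a b))"
  unfolding average_def
  by (simp add: sum_divide_distrib[symmetric] mult.commute sum.swap[of _ B A])

lemma average_PiE_insert:
  assumes "finite I" "i \<notin> I"
  shows "average (PiE (insert i I) T) F = average (T i) (\<lambda>h. average (PiE I T) (\<lambda>g. F (g(i := h))))"
  unfolding average_def using assms
  by (simp add: sum_PiE_insert card_PiE sum_divide_distrib[symmetric] mult.commute)

text \<open>The coordinates in \<open>I\<close> are replaced one at a time, at a cost of at most
  \<open>\<eta>\<close> each. The assumption concerns every assignment \<open>x\<close>, so it also
  covers the mixed assignments in between.\<close>

lemma hybrid_argument:
  fixes A :: "('i \<Rightarrow> 'h) \<Rightarrow> real" and \<eta> :: real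
  assumes "finite I" "finite H" "H \<noteq> {}" "finite Z" "Z \<noteq> {}"
    and "\<And>i x. i \<in> I \<Longrightarrow> average Z (\<lambda>z. A (x(i := d z))) \<le> average H (\<lambda>h. A (x(i := h))) + \<eta>"
  shows "average (I \<rightarrow>\<^sub>E Z) (\<lambda>z. A (\<lambda>i. if i \<in> I then d (z i) else b i))
    \<le> average (I \<rightarrow>\<^sub>E H) (\<lambda>x. A (\<lambda>i. if i \<in> I then x i else b i)) + card I * \<eta>"
  using assms(1,6)
proof (induction I arbitrary: A)
  case empty
  then show ?case by (simp add: average_def)
next
  case (insert i I)
  let ?z = "\<lambda>z. \<lambda>j. if j \<in> I then d (z j) else b j" and ?x = "\<lambda>x. \<lambda>j. if j \<in> I then x j else b j"
  have z: "(\<lambda>j. if j \<in> insert i I then d ((g(i := h)) j) else b j) = (?z g)(i := d h)" for g h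
    using insert.hyps by auto
  have x: "(\<lambda>j. if j \<in> insert i I then (g(i := h)) j else b j) = (?x g)(i := h)" for g h
    using insert.hyps by auto
  have ne: "finite (I \<rightarrow>\<^sub>E Z)" "(I \<rightarrow>\<^sub>E Z) \<noteq> {}"
    using insert.hyps assms by (auto intro: finite_PiE simp: PiE_eq_empty_iff)
  \<comment> \<open>The induction hypothesis is used for \<open>A\<close> with coordinate
    \<open>i\<close> frozen at \<open>h\<close>, which is why the induction generalises over
    \<open>A\<close>.\<close>
  have IH: "average (I \<rightarrow>\<^sub>E Z) (\<lambda>g. A ((?z g)(i := h))) \<le>
      average (I \<rightarrow>\<^sub>E H) (\<lambda>g. A ((?x g)(i := h))) + card I * \<eta>" for h
  proof (rule insert.IH)
    fix j x assume "j \<in> I"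
    then have "average Z (\<lambda>z. A (x(i := h, j := d z))) \<le> average H (\<lambda>h'. A (x(i := h, j := h'))) + \<eta>"
      by (intro insert.prems) simp
    moreover have "x(j := y, i := h) = x(i := h, j := y)" for y
      using \<open>j \<in> I\<close> insert.hyps by (intro fun_upd_twist) auto
    ultimately show "average Z (\<lambda>z. A (x(j := d z, i := h))) \<le> average H (\<lambda>h'. A (x(j := h', i := h))) + \<eta>"
      by simp
  qed
  have "average (insert i I \<rightarrow>\<^sub>E Z) (\<lambda>z. A (\<lambda>j. if j \<in> insert i I then d (z j) else b j)) =
    average (I \<rightarrow>\<^sub>E Z) (\<lambda>g. average Z (\<lambda>h. A ((?z g)(i := d h))))"
    unfolding average_PiE_insert[OF insert.hyps] z by (rule average_swap)
  also have "\<dots> \<le> average (I \<rightarrow>\<^sub>E Z) (\<lambda>g. average H (\<lambda>h. A ((?z g)(i := h))) + \<eta>)"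
    by (intro average_mono insert.prems) simp
  also have "\<dots> = average H (\<lambda>h. average (I \<rightarrow>\<^sub>E Z) (\<lambda>g. A ((?z g)(i := h)))) + \<eta>"
    by (simp add: average_add_const[OF ne] average_swap[of H])
  also have "\<dots> \<le> average H (\<lambda>h. average (I \<rightarrow>\<^sub>E H) (\<lambda>g. A ((?x g)(i := h))) + card I * \<eta>) + \<eta>"
    by (intro add_right_mono average_mono IH)
  also have "\<dots> = average (insert i I \<rightarrow>\<^sub>E H) (\<lambda>x. A (\<lambda>j. if j \<in> insert i I then x j else b j)) +
      card (insert i I) * \<eta>"
    unfolding average_PiE_insert[OF insert.hyps] x average_add_const[OF assms(2,3)]
    using insert.hyps by (simp add: algebra_simps)
  finally show ?case .
qed

section \<open>Straight-line programs\<close>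

definition nodes :: "bgate list \<Rightarrow> bool list \<Rightarrow> bool list" where
  "nodes gs x = fold (\<lambda>g v. v @ [bgate_value v g]) gs x"

lemma nodes_snoc: "nodes (gs @ [g]) x = nodes gs x @ [bgate_value (nodes gs x) g]"
  by (simp add: nodes_def)

lemma length_nodes [simp]: "length (nodes gs x) = length x + length gs"
  by (induction gs rule: rev_induct) (simp_all add: nodes_snoc, simp add: nodes_def)

definition straight_line :: "nat \<Rightarrow> bgate list \<Rightarrow> bool" where
  "straight_line m gs \<longleftrightarrow> (\<forall>k < length gs. \<forall>i \<in> bgate_args (gs ! k). i < m + k)"

definition computes :: "nat \<Rightarrow> bgate list \<Rightarrow> (bool list \<Rightarrow> bool) \<Rightarrow> bool" where
  "computes m gs f \<longleftrightarrow> (\<exists>i < m + length gs. \<forall>x. length x = m \<longrightarrow> nodes gs x ! i = f x)"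

text \<open>All functions in \<open>F\<close> are nodes of one program, so that later gates can
  share them and their cost is counted once.\<close>

definition jointly_computable :: "nat \<Rightarrow> nat \<Rightarrow> (bool list \<Rightarrow> bool) set \<Rightarrow> bool" where
  "jointly_computable m s F \<longleftrightarrow>
     (\<exists>gs. straight_line m gs \<and> length gs \<le> s \<and> (\<forall>f\<in>F. computes m gs f))"

lemma jointly_computable_mono:
  "jointly_computable m s F \<Longrightarrow> F' \<subseteq> F \<Longrightarrow> s \<le> s' \<Longrightarrow> jointly_computable m s' F'"
  unfolding jointly_computable_def by (meson order_trans subsetD)

lemma jointly_computable_projections: "jointly_computable m 0 ((\<lambda>i x. x ! i) ` {..<m})"
  unfolding jointly_computable_def
  by (intro exI[of _ "[]"]) (auto simp: straight_line_def computes_def nodes_def)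

lemma straight_line_snoc:
  assumes "straight_line m gs" "\<And>i. i \<in> bgate_args g \<Longrightarrow> i < m + length gs"
  shows "straight_line m (gs @ [g])"
  using assms by (auto simp: straight_line_def nth_append less_Suc_eq)

lemma computes_snoc:
  assumes "computes m gs f"
  shows "computes m (gs @ [g]) f"
proof -
  obtain i where "i < m + length gs" "\<forall>x. length x = m \<longrightarrow> nodes gs x ! i = f x"
    using assms by (auto simp: computes_def)
  then show ?thesis
    unfolding computes_def by (intro exI[of _ i]) (auto simp: nodes_snoc nth_append)
qed

lemma computes_gate:
  "(\<And>x. length x = m \<Longrightarrow> bgate_value (nodes gs x) g = f x) \<Longrightarrow> computes m (gs @ [g]) f"
  unfolding computes_def
  by (intro exI[of _ "m + length gs"]) (auto simp: nodes_snoc nth_append)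

lemma jointly_computable_gate:
  assumes "straight_line m gs" "length gs \<le> s" "\<And>f. f \<in> F \<Longrightarrow> computes m gs f"
    and "\<And>i. i \<in> bgate_args g \<Longrightarrow> i < m + length gs"
    and "\<And>x. length x = m \<Longrightarrow> bgate_value (nodes gs x) g = h x"
  shows "jointly_computable m (Suc s) (insert h F)"
proof -
  have "straight_line m (gs @ [g])" using assms(1,4) by (rule straight_line_snoc)
  moreover have "computes m (gs @ [g]) f" if "f \<in> insert h F" for f
    using that assms(3,5) by (auto intro: computes_snoc computes_gate)
  moreover have "length (gs @ [g]) \<le> Suc s" using assms(2) by simp
  ultimately show ?thesis unfolding jointly_computable_def by blast
qed

section \<open>Extending programs and disjunctive normal forms\<close>

lemma jointly_computable_and:
  assumes "jointly_computable m s F" "f \<in> F" "g \<in> F"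
  shows "jointly_computable m (Suc s) (insert (\<lambda>x. f x \<and> g x) F)"
proof -
  obtain gs where gs: "straight_line m gs" "length gs \<le> s" "\<And>f. f \<in> F \<Longrightarrow> computes m gs f"
    using assms(1) by (auto simp: jointly_computable_def)
  obtain i where i: "i < m + length gs" "\<forall>x. length x = m \<longrightarrow> nodes gs x ! i = f x"
    using gs(3)[OF assms(2)] unfolding computes_def by blast
  obtain j where j: "j < m + length gs" "\<forall>x. length x = m \<longrightarrow> nodes gs x ! j = g x"
    using gs(3)[OF assms(3)] unfolding computes_def by blast
  show ?thesis
    by (rule jointly_computable_gate[OF gs, where g = "And i j"]) (use i j in auto)
qed

lemma jointly_computable_or:
  assumes "jointly_computable m s F" "f \<in> F" "g \<in> F"
  shows "jointly_computable m (Suc s) (insert (\<lambda>x. f x \<or> g x) F)"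
proof -
  obtain gs where gs: "straight_line m gs" "length gs \<le> s" "\<And>f. f \<in> F \<Longrightarrow> computes m gs f"
    using assms(1) by (auto simp: jointly_computable_def)
  obtain i where i: "i < m + length gs" "\<forall>x. length x = m \<longrightarrow> nodes gs x ! i = f x"
    using gs(3)[OF assms(2)] unfolding computes_def by blast
  obtain j where j: "j < m + length gs" "\<forall>x. length x = m \<longrightarrow> nodes gs x ! j = g x"
    using gs(3)[OF assms(3)] unfolding computes_def by blast
  show ?thesis
    by (rule jointly_computable_gate[OF gs, where g = "Or i j"]) (use i j in auto)
qed

lemma jointly_computable_not:
  assumes "jointly_computable m s F" "f \<in> F"
  shows "jointly_computable m (Suc s) (insert (\<lambda>x. \<not> f x) F)"
proof -
  obtain gs where gs: "straight_line m gs" "length gs \<le> s" "\<And>f. f \<in> F \<Longrightarrow> computes m gs f"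
    using assms(1) by (auto simp: jointly_computable_def)
  obtain i where i: "i < m + length gs" "\<forall>x. length x = m \<longrightarrow> nodes gs x ! i = f x"
    using gs(3)[OF assms(2)] unfolding computes_def by blast
  show ?thesis
    by (rule jointly_computable_gate[OF gs, where g = "Not i"]) (use i in auto)
qed

text \<open>The functions are added one after the other. The assumption allows any larger set
  \<open>G\<close>, because the nodes for the functions added before are still present.\<close>

lemma jointly_computable_family:
  assumes "finite J" "jointly_computable m s F"
    and "\<And>j s' G. j \<in> J \<Longrightarrow> F \<subseteq> G \<Longrightarrow> jointly_computable m s' G \<Longrightarrow>
           jointly_computable m (s' + q) (insert (h j) G)"
  shows "jointly_computable m (s + card J * q) (F \<union> h ` J)"
  using assms(1,3)
proof (induction J)
  case empty
  then show ?case using assms(2) by simp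
next
  case (insert j J)
  have "jointly_computable m (s + card J * q + q) (insert (h j) (F \<union> h ` J))"
    using insert by (intro insert.prems) auto
  then show ?case using insert.hyps by (simp add: add_ac)
qed

text \<open>All literals are nodes already, so each position of \<open>a\<close> costs one AND gate.
  The empty conjunction is the node for \<open>True\<close>.\<close>

lemma jointly_computable_minterm:
  assumes "jointly_computable m s F" "(\<lambda>_. True) \<in> F"
    and "set ws \<subseteq> F" "(\<lambda>w x. \<not> w x) ` set ws \<subseteq> F" "length a = length ws"
  shows "jointly_computable m (s + length ws) (insert (\<lambda>x. map (\<lambda>w. w x) ws = a) F)"
  using assms(5,3,4)
proof (induction a ws rule: list_induct2)
  case Nil
  then show ?case using assms(1,2) by (simp add: insert_absorb)
next
  case (Cons b a w ws)
  let ?f = "\<lambda>x. map (\<lambda>w. w x) ws = a" and ?l = "if b then w else (\<lambda>x. \<not> w x)"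
  have "jointly_computable m (s + length ws) (insert ?f F)"
    using Cons by auto
  moreover have "?l \<in> F" using Cons.prems by auto
  ultimately have "jointly_computable m (Suc (s + length ws)) (insert (\<lambda>x. ?l x \<and> ?f x) (insert ?f F))"
    by (intro jointly_computable_and) auto
  moreover have "(\<lambda>x. ?l x \<and> ?f x) = (\<lambda>x. map (\<lambda>w. w x) (w # ws) = b # a)" by auto
  ultimately show ?case by (auto intro: jointly_computable_mono)
qed

text \<open>The negations cost at most \<open>length ws\<close> gates and the two constants one gate
  each; they are made from the first function and its negation, so \<open>ws\<close> must not be
  empty. Each element of \<open>S\<close> then costs a minterm and one OR gate.\<close>

lemma jointly_computable_dnf:
  assumes F: "jointly_computable m s F" and ws: "set ws \<subseteq> F" "ws \<noteq> []"
    and S: "finite S" "\<And>a. a \<in> S \<Longrightarrow> length a = length ws"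
  shows "jointly_computable m (s + (card S + 2) * (length ws + 1))
           (insert (\<lambda>x. map (\<lambda>w. w x) ws \<in> S) F)"
proof -
  let ?neg = "\<lambda>w x. \<not> w x" and ?w = "hd ws"
  let ?G = "F \<union> ?neg ` set ws"
  have "jointly_computable m (s + card (set ws) * 1) ?G"
    using F by (intro jointly_computable_family) (use ws in \<open>auto intro: jointly_computable_not\<close>)
  then have "jointly_computable m (s + length ws) ?G"
    by (rule jointly_computable_mono) (auto intro: card_length)
  moreover have w: "?w \<in> ?G" "?neg ?w \<in> ?G" using ws by auto
  ultimately have "jointly_computable m (Suc (s + length ws)) (insert (\<lambda>x. ?w x \<and> \<not> ?w x) ?G)"
    by (rule jointly_computable_and)
  then have "jointly_computable m (Suc (Suc (s + length ws)))
      (insert (\<lambda>x. ?w x \<or> \<not> ?w x) (insert (\<lambda>x. ?w x \<and> \<not> ?w x) ?G))"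
    by (rule jointly_computable_or) (use w in auto)
  then have const: "jointly_computable m (s + length ws + 2) (?G \<union> {\<lambda>_. True, \<lambda>_. False})"
    by (rule jointly_computable_mono) auto
  let ?H = "?G \<union> {\<lambda>_. True, \<lambda>_. False}"
  from S have "jointly_computable m (s + length ws + 2 + card S * (length ws + 1))
      (insert (\<lambda>x. map (\<lambda>w. w x) ws \<in> S) ?H)"
  proof (induction S)
    case empty
    then show ?case using const by (simp add: insert_absorb)
  next
    case (insert a S)
    let ?f = "\<lambda>x. map (\<lambda>w. w x) ws \<in> S" and ?g = "\<lambda>x. map (\<lambda>w. w x) ws = a"
    have "jointly_computable m (s + length ws + 2 + card S * (length ws + 1)) (insert ?f ?H)"
      using insert by auto
    then have "jointly_computable m (s + length ws + 2 + card S * (length ws + 1) + length ws)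
        (insert ?g (insert ?f ?H))"
      by (rule jointly_computable_minterm) (use ws insert.prems in auto)
    then have "jointly_computable m (Suc (s + length ws + 2 + card S * (length ws + 1) + length ws))
        (insert (\<lambda>x. ?g x \<or> ?f x) (insert ?g (insert ?f ?H)))"
      by (rule jointly_computable_or) auto
    moreover have "(\<lambda>x. ?g x \<or> ?f x) = (\<lambda>x. map (\<lambda>w. w x) ws \<in> insert a S)" by auto
    ultimately have "jointly_computable m (Suc (s + length ws + 2 + card S * (length ws + 1) + length ws))
        (insert (\<lambda>x. map (\<lambda>w. w x) ws \<in> insert a S) (insert ?g (insert ?f ?H)))"
      by (simp only:)
    then show ?case
      by (rule jointly_computable_mono) (use insert.hyps in \<open>blast, simp\<close>)
  qed
  then show ?thesis by (rule jointly_computable_mono) (auto simp: algebra_simps)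
qed

section \<open>Truth tables\<close>

abbreviation bits_to_nat :: "bool list \<Rightarrow> nat" where
  "bits_to_nat \<equiv> horner_sum of_bool 2"

definition nat_to_bits :: "nat \<Rightarrow> nat \<Rightarrow> bool list" where
  "nat_to_bits w v = map (bit v) [0..<w]"

lemma length_nat_to_bits [simp]: "length (nat_to_bits w v) = w"
  by (simp add: nat_to_bits_def)

lemma bits_to_nat_less: "bits_to_nat x < 2 ^ length x"
  by (rule horner_sum_of_bool_2_less)

lemma bits_to_nat_to_bits: "v < 2 ^ w \<Longrightarrow> bits_to_nat (nat_to_bits w v) = v"
  by (simp add: nat_to_bits_def horner_sum_bit_eq_take_bit take_bit_nat_eq_self)

lemma bits_to_nat_inj: "bits_to_nat x = bits_to_nat y \<Longrightarrow> length x = length y \<Longrightarrow> x = y"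
proof (rule nth_equalityI)
  assume "bits_to_nat x = bits_to_nat y" "length x = length y"
  then have "i < length x \<and> x ! i \<longleftrightarrow> i < length y \<and> y ! i" for i
    using bit_horner_sum_bit_iff[of x i, where ?'a = nat] bit_horner_sum_bit_iff[of y i, where ?'a = nat]
    by simp
  then show "x ! i = y ! i" if "i < length x" for i
    using that \<open>length x = length y\<close> by auto
qed simp

text \<open>With the least significant bit first, the first \<open>\<kappa>\<close> variables give
  the position within an aligned block and the remaining ones the block number.\<close>

lemma bits_to_nat_drop_take:
  assumes "\<kappa> \<le> length x"
  shows "bits_to_nat x div 2 ^ \<kappa> = bits_to_nat (drop \<kappa> x)"
    "bits_to_nat x mod 2 ^ \<kappa> = bits_to_nat (take \<kappa> x)"
proof -
  have "bits_to_nat x = bits_to_nat (take \<kappa> x) + 2 ^ \<kappa> * bits_to_nat (drop \<kappa> x)"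
    using horner_sum_append[of of_bool "2::nat" "take \<kappa> x" "drop \<kappa> x"] assms by simp
  moreover have "bits_to_nat (take \<kappa> x) < 2 ^ \<kappa>"
    using bits_to_nat_less[of "take \<kappa> x"] assms by simp
  ultimately show "bits_to_nat x div 2 ^ \<kappa> = bits_to_nat (drop \<kappa> x)"
    "bits_to_nat x mod 2 ^ \<kappa> = bits_to_nat (take \<kappa> x)" by auto
qed

lemma card_bits_le:
  assumes "finite U"
  shows "finite {y. length y = w \<and> bits_to_nat y \<in> U} \<and> card {y. length y = w \<and> bits_to_nat y \<in> U} \<le> card U"
proof -
  have inj: "inj_on bits_to_nat {y. length y = w \<and> bits_to_nat y \<in> U}"
    by (auto intro!: inj_onI bits_to_nat_inj)
  moreover have "bits_to_nat ` {y. length y = w \<and> bits_to_nat y \<in> U} \<subseteq> U" by auto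
  ultimately show ?thesis
    using assms by (meson card_inj_on_le finite_imageD finite_subset)
qed

lemma card_bool_lists: "finite {y :: bool list. length y = w}" "card {y :: bool list. length y = w} = 2 ^ w"
  using finite_lists_length_eq[of "UNIV :: bool set" w] card_lists_length_eq[of "UNIV :: bool set" w]
  by simp_all

text \<open>\<open>MCSP\<close> for a fixed number of variables and an integer size bound, which
  makes it a finite set that can be counted.\<close>

definition small_tables :: "nat \<Rightarrow> nat \<Rightarrow> bool list set" where
  "small_tables m s = {t. length t = 2 ^ m \<and>
     (\<exists>B. wf_boolean_circuit m B \<and> boolean_size B \<le> s \<and>
          (\<forall>x. length x = m \<longrightarrow> boolean_eval B x = truth_table_fun t x))}"

lemma small_tablesI:
  assumes "jointly_computable m s F" "f \<in> F" "length t = 2 ^ m"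
    and "\<And>x. length x = m \<Longrightarrow> t ! bits_to_nat x = f x"
  shows "t \<in> small_tables m s"
proof -
  obtain gs i where gs: "straight_line m gs" "length gs \<le> s" "i < m + length gs"
    "\<And>x. length x = m \<Longrightarrow> nodes gs x ! i = f x"
    using assms(1,2) unfolding jointly_computable_def computes_def by meson
  let ?B = "\<lparr>bgates = gs, output_node = i\<rparr>"
  have "wf_boolean_circuit m ?B" "boolean_size ?B \<le> s"
    "\<forall>x. length x = m \<longrightarrow> boolean_eval ?B x = truth_table_fun t x"
    using gs assms(4) by (auto simp: wf_boolean_circuit_def straight_line_def boolean_size_def
        boolean_eval_def nodes_def truth_table_fun_def)
  then show ?thesis using assms(3) unfolding small_tables_def by blast
qed

text \<open>A table is determined by a gate list and an output node. All nodes are below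
  \<open>m + s\<close>, which leaves at most \<open>3 * (m + s)\<^sup>2\<close> different gates; one
  more symbol accounts for lists shorter than \<open>s\<close>.\<close>

lemma small_tables_finite_card:
  assumes "0 < m"
  shows "finite (small_tables m s) \<and> card (small_tables m s) \<le> (4 * (m + s)\<^sup>2) ^ s * (m + s)"
proof -
  let ?N = "{..<m + s}"
  define G where "G = (\<lambda>(i, j). And i j) ` (?N \<times> ?N) \<union> (\<lambda>(i, j). Or i j) ` (?N \<times> ?N) \<union> Not ` ?N"
  let ?L = "{gs. set gs \<subseteq> G \<and> length gs \<le> s}"
  let ?t = "\<lambda>(gs, i). map (\<lambda>v. nodes gs (nat_to_bits m v) ! i) [0..<2 ^ m]"
  have finG: "finite G" by (simp add: G_def)
  have "card G \<le> card (?N \<times> ?N) + card (?N \<times> ?N) + card ?N"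
    unfolding G_def by (intro order_trans[OF card_Un_le] add_mono card_image_le) auto
  also have "\<dots> \<le> 3 * (m + s)\<^sup>2"
  proof -
    have "(m + s) * 1 \<le> (m + s) * (m + s)" using assms by (intro mult_le_mono2) auto
    then show ?thesis by (simp add: power2_eq_square card_cartesian_product)
  qed
  finally have "card G + 1 \<le> 3 * (m + s)\<^sup>2 + 1" by simp
  also have "\<dots> \<le> 4 * (m + s)\<^sup>2" using assms by simp
  finally have cardG: "card G + 1 \<le> 4 * (m + s)\<^sup>2" .
  have "card ?L \<le> (card G + 1) ^ s"
    using card_lists_length_le[OF finG] sum_power_le[of "card G" s] by simp
  also have "\<dots> \<le> (4 * (m + s)\<^sup>2) ^ s" using cardG by (intro power_mono) auto
  finally have cardL: "card ?L \<le> (4 * (m + s)\<^sup>2) ^ s" .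
  have finL: "finite ?L" by (rule finite_lists_length_le[OF finG])
  have sub: "small_tables m s \<subseteq> ?t ` (?L \<times> ?N)"
  proof
    fix t assume "t \<in> small_tables m s"
    then obtain B where t: "length t = 2 ^ m" and B: "wf_boolean_circuit m B" "boolean_size B \<le> s"
      "\<And>x. length x = m \<Longrightarrow> boolean_eval B x = truth_table_fun t x"
      unfolding small_tables_def by blast
    have "g \<in> G" if g: "g \<in> set (bgates B)" for g
    proof -
      obtain k where "k < length (bgates B)" "g = bgates B ! k"
        using g by (metis in_set_conv_nth)
      then have "\<forall>i\<in>bgate_args g. i < m + k" "k \<le> s"
        using B(1,2) by (auto simp: wf_boolean_circuit_def boolean_size_def)
      then have "\<forall>i\<in>bgate_args g. i < m + s" by (meson add_left_mono order_less_le_trans)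
      then show ?thesis unfolding G_def by (cases g) auto
    qed
    then have "(bgates B, output_node B) \<in> ?L \<times> ?N"
      using B(1,2) by (auto simp: wf_boolean_circuit_def boolean_size_def)
    moreover have "t = ?t (bgates B, output_node B)"
    proof (rule nth_equalityI)
      fix v assume "v < length t"
      then have v: "v < 2 ^ m" using t by simp
      then show "t ! v = ?t (bgates B, output_node B) ! v"
        using B(3)[of "nat_to_bits m v"] bits_to_nat_to_bits[OF v]
        by (simp add: boolean_eval_def nodes_def truth_table_fun_def)
    qed (use t in simp)
    ultimately show "t \<in> ?t ` (?L \<times> ?N)" by blast
  qed
  have "card (small_tables m s) \<le> card (?L \<times> ?N)"
    using sub finL by (meson card_image_le card_mono finite_SigmaI finite_imageI finite_lessThan order_trans)
  also have "\<dots> \<le> (4 * (m + s)\<^sup>2) ^ s * (m + s)"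
    using cardL by (simp add: card_cartesian_product)
  finally show ?thesis using finite_subset[OF sub] finL by simp
qed

text \<open>Everything outside the blocks in \<open>U\<close> is zero, so that the circuit size
  depends on the number of these blocks and not on the number of all blocks.\<close>

definition block_table :: "nat \<Rightarrow> nat \<Rightarrow> nat set \<Rightarrow> (nat \<Rightarrow> nat set) \<Rightarrow> bool list" where
  "block_table m \<kappa> U x = map (\<lambda>v. v div 2 ^ \<kappa> \<in> U \<and> v mod 2 ^ \<kappa> \<in> x (v div 2 ^ \<kappa>)) [0..<2 ^ m]"

text \<open>The summands pay for the test of the block number together with the
  \<open>c * \<rho>\<close> pointer bits, for the \<open>c\<close> table lookups, and for the final
  parity. Each factor is the cost of a disjunctive normal form.\<close>

definition xor_circuit_size :: "nat \<Rightarrow> nat \<Rightarrow> nat \<Rightarrow> nat \<Rightarrow> nat \<Rightarrow> nat" where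
  "xor_circuit_size m \<kappa> \<rho> c T = (c * \<rho> + 1) * ((T + 2) * (m + 1)) +
     c * ((2 ^ (\<rho> + \<kappa>) + 2) * (\<rho> + \<kappa> + 1)) + (2 ^ (c + 1) + 2) * (c + 2)"

lemma jointly_computable_dnf_mono:
  assumes "jointly_computable m s F" "set ws \<subseteq> F" "ws \<noteq> []"
    and "finite S" "\<And>a. a \<in> S \<Longrightarrow> length a = length ws"
    and "card S \<le> N" "length ws \<le> w"
  shows "jointly_computable m (s + (N + 2) * (w + 1)) (insert (\<lambda>x. map (\<lambda>w. w x) ws \<in> S) F)"
proof -
  have "(card S + 2) * (length ws + 1) \<le> (N + 2) * (w + 1)"
    using assms(6,7) by (intro mult_le_mono) auto
  then show ?thesis
    by (intro jointly_computable_mono[OF jointly_computable_dnf[OF assms(1-5)]]) auto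
qed

text \<open>The pointers \<open>z u j\<close> are computed from the block number \<open>u\<close>, and then the tables are read
  at these addresses.\<close>

lemma block_table_xor_small:
  assumes "\<kappa> < m" "0 < \<kappa>" "finite U" and z: "\<And>u j. u \<in> U \<Longrightarrow> j < c \<Longrightarrow> z u j < 2 ^ \<rho>"
  shows "block_table m \<kappa> U (\<lambda>u. table_xor c X (z u)) \<in>
    small_tables m (xor_circuit_size m \<kappa> \<rho> c (card U))"
proof -
  define P where "P = (\<lambda>i (x :: bool list). x ! i) ` {..<m}"
  \<comment> \<open>\<open>high\<close> reads the block number, \<open>sel\<close> tests whether it
    belongs to \<open>U\<close>, and \<open>addr (j, b)\<close> is bit \<open>b\<close> of the
    pointer into table \<open>j\<close>.\<close>
  define high where "high = map (\<lambda>i (x :: bool list). x ! i) [\<kappa>..<m]"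
  define selS where "selS = {y. length y = m - \<kappa> \<and> bits_to_nat y \<in> U}"
  define addrS where "addrS = (\<lambda>(j, b). {y \<in> selS. bit (z (bits_to_nat y) j) b})"
  define sel where "sel = (\<lambda>x. map (\<lambda>w. w x) high \<in> selS)"
  define addr where "addr = (\<lambda>jb x. map (\<lambda>w. w x) high \<in> addrS jb)"
  \<comment> \<open>A lookup in table \<open>j\<close> reads the pointer bits followed by the
    position within the block.\<close>
  define look where "look j = map (\<lambda>b. addr (j, b)) [0..<\<rho>] @ map (\<lambda>i x. x ! i) [0..<\<kappa>]" for j
  define lookS where "lookS j =
    {y. length y = \<rho> + \<kappa> \<and> bits_to_nat (drop \<rho> y) \<in> X (j, bits_to_nat (take \<rho> y))}" for j
  define entry where "entry = (\<lambda>j x. map (\<lambda>w. w x) (look j) \<in> lookS j)"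
  define out where "out = sel # map entry [0..<c]"
  \<comment> \<open>Index 0 holds the value of \<open>sel\<close>, so the entries are shifted by
    one. The conjunct \<open>y ! 0\<close> forces zeros outside \<open>U\<close>, where the lookups
    may return anything.\<close>
  define outS where "outS = {y. length y = c + 1 \<and> y ! 0 \<and> odd (card {j. j < c \<and> y ! (j + 1)})}"
  define result where "result = (\<lambda>x. map (\<lambda>w. w x) out \<in> outS)"
  let ?q1 = "(card U + 2) * (m + 1)" and ?q2 = "(2 ^ (\<rho> + \<kappa>) + 2) * (\<rho> + \<kappa> + 1)"
  let ?F2 = "insert sel P \<union> addr ` ({..<c} \<times> {..<\<rho>})"

  have selS: "finite selS" "card selS \<le> card U"
    using card_bits_le[OF \<open>finite U\<close>] by (auto simp: selS_def)
  have addrS: "finite (addrS jb)" "card (addrS jb) \<le> card U" for jb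
  proof -
    have sub: "addrS jb \<subseteq> selS" by (auto simp: addrS_def split: prod.splits)
    show "finite (addrS jb)" "card (addrS jb) \<le> card U"
      using finite_subset[OF sub] card_mono[OF _ sub] selS by auto
  qed
  have high: "set high \<subseteq> P" "high \<noteq> []" "length high = m - \<kappa>" "length high \<le> m"
    using \<open>\<kappa> < m\<close> by (auto simp: high_def P_def)
  have "jointly_computable m 0 P"
    unfolding P_def by (rule jointly_computable_projections)
  then have "jointly_computable m (0 + ?q1) (insert sel P)"
    unfolding sel_def
    by (rule jointly_computable_dnf_mono) (use high selS in \<open>auto simp: selS_def\<close>)
  then have "jointly_computable m (0 + ?q1 + card ({..<c} \<times> {..<\<rho>}) * ?q1) ?F2"
  proof (rule jointly_computable_family[rotated])
    fix jb s G assume "insert sel P \<subseteq> G" "jointly_computable m s G"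
    then show "jointly_computable m (s + ?q1) (insert (addr jb) G)"
      unfolding addr_def
      by (intro jointly_computable_dnf_mono)
        (use high addrS in \<open>auto simp: addrS_def selS_def split: prod.splits\<close>)
  qed simp
  then have "jointly_computable m (0 + ?q1 + card ({..<c} \<times> {..<\<rho>}) * ?q1 + card {..<c} * ?q2)
      (?F2 \<union> entry ` {..<c})"
  proof (rule jointly_computable_family[rotated])
    fix j s G assume j: "j \<in> {..<c}" and G: "?F2 \<subseteq> G" "jointly_computable m s G"
    have "lookS j \<subseteq> {y. length y = \<rho> + \<kappa>}" by (auto simp: lookS_def)
    then have "finite (lookS j)" "card (lookS j) \<le> 2 ^ (\<rho> + \<kappa>)"
      using card_mono[of "{y. length y = \<rho> + \<kappa>}" "lookS j"] card_bool_lists[of "\<rho> + \<kappa>"]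
      by (auto intro: finite_subset)
    moreover have "set (look j) \<subseteq> ?F2"
      using j \<open>\<kappa> < m\<close> by (auto simp: look_def P_def)
    then have "set (look j) \<subseteq> G" using G(1) by (rule order_trans)
    moreover have "length (look j) = \<rho> + \<kappa>" by (simp add: look_def)
    then have "look j \<noteq> []" "length (look j) = \<rho> + \<kappa>" using \<open>0 < \<kappa>\<close> by auto
    ultimately show "jointly_computable m (s + ?q2) (insert (entry j) G)"
      unfolding entry_def using G(2)
      by (intro jointly_computable_dnf_mono) (simp_all add: lookS_def)
  qed simp
  moreover have "finite outS" "card outS \<le> 2 ^ (c + 1)"
  proof -
    have sub: "outS \<subseteq> {y. length y = c + 1}" by (auto simp: outS_def)
    then show "finite outS" by (rule finite_subset) (rule card_bool_lists)
    show "card outS \<le> 2 ^ (c + 1)"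
      using card_mono[OF _ sub] card_bool_lists[of "c + 1"] by simp
  qed
  ultimately have "jointly_computable m
      (0 + ?q1 + card ({..<c} \<times> {..<\<rho>}) * ?q1 + card {..<c} * ?q2 + (2 ^ (c + 1) + 2) * (c + 1 + 1))
      (insert result (?F2 \<union> entry ` {..<c}))"
    unfolding result_def
    by (intro jointly_computable_dnf_mono) (auto simp: out_def outS_def)
  then have res: "jointly_computable m (xor_circuit_size m \<kappa> \<rho> c (card U)) {result}"
    by (rule jointly_computable_mono)
      (auto simp: xor_circuit_size_def card_cartesian_product algebra_simps)

  have val: "result x \<longleftrightarrow> bits_to_nat (drop \<kappa> x) \<in> U \<and>
      bits_to_nat (take \<kappa> x) \<in> table_xor c X (z (bits_to_nat (drop \<kappa> x)))"
    if x: "length x = m" for x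
  proof -
    let ?u = "bits_to_nat (drop \<kappa> x)"
    have h: "map (\<lambda>w. w x) high = drop \<kappa> x"
      using x by (intro nth_equalityI) (auto simp: high_def)
    have s: "sel x \<longleftrightarrow> ?u \<in> U" unfolding sel_def h selS_def using x by auto
    have e: "entry j x \<longleftrightarrow> bits_to_nat (take \<kappa> x) \<in> X (j, z ?u j)" if u: "?u \<in> U" and j: "j < c" for j
    proof -
      have "addr (j, b) x \<longleftrightarrow> bit (z ?u j) b" for b
        unfolding addr_def h addrS_def selS_def using x u by auto
      then have "map (\<lambda>w. w x) (look j) = nat_to_bits \<rho> (z ?u j) @ take \<kappa> x"
        using x \<open>\<kappa> < m\<close> by (auto simp: look_def nat_to_bits_def intro!: nth_equalityI)
      then show ?thesis
        unfolding entry_def lookS_def using x \<open>\<kappa> < m\<close> z[OF u j]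
        by (simp add: bits_to_nat_to_bits)
    qed
    have "result x \<longleftrightarrow> sel x \<and> odd (card {j. j < c \<and> entry j x})"
      unfolding result_def outS_def out_def by (auto cong: conj_cong simp: nth_Cons')
    also have "\<dots> \<longleftrightarrow> ?u \<in> U \<and> odd (card {j. j < c \<and> bits_to_nat (take \<kappa> x) \<in> X (j, z ?u j)})"
      using s e by (auto cong: conj_cong)
    finally show ?thesis by (simp add: table_xor_def)
  qed
  show ?thesis
  proof (rule small_tablesI[OF res, of result])
    fix x :: "bool list" assume x: "length x = m"
    then have "bits_to_nat x < 2 ^ m" using bits_to_nat_less[of x] by simp
    then show "block_table m \<kappa> U (\<lambda>u. table_xor c X (z u)) ! bits_to_nat x = result x"
      using val[OF x] bits_to_nat_drop_take[of \<kappa> x] x \<open>\<kappa> < m\<close> by (simp add: block_table_def)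
  qed (simp_all add: block_table_def)
qed

section \<open>Residual functions of a comparator circuit\<close>

text \<open>The size does not bound the number of wires, but only wires that are touched by a gate
  or serve as the output can matter.\<close>

definition relevant_wires :: "comparator_circuit \<Rightarrow> nat set" where
  "relevant_wires C = insert (output_wire C) (fst ` set (cgates C) \<union> snd ` set (cgates C))"

lemma finite_relevant_wires: "finite (relevant_wires C)"
  by (simp add: relevant_wires_def)

lemma card_relevant_wires: "card (relevant_wires C) \<le> 2 * comparator_size C + 1"
proof -
  have "card (fst ` set (cgates C)) \<le> length (cgates C)" "card (snd ` set (cgates C)) \<le> length (cgates C)"
    by (meson card_image_le card_length finite_set order_trans)+
  then have "card (fst ` set (cgates C) \<union> snd ` set (cgates C)) \<le> 2 * length (cgates C)"
    using card_Un_le[of "fst ` set (cgates C)" "snd ` set (cgates C)"] by simp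
  then show ?thesis
    unfolding relevant_wires_def comparator_size_def by (simp add: card_insert_if)
qed

definition block_wires :: "comparator_circuit \<Rightarrow> nat \<Rightarrow> nat \<Rightarrow> nat set" where
  "block_wires C \<kappa> u = {i \<in> relevant_wires C. lit_var (wire_labels C ! i) div 2 ^ \<kappa> = u}"

text \<open>The initial wire values as predicates on the block content \<open>h\<close>. They do not
  depend on the other blocks, so a table with block \<open>u\<close> alone defines them, and one
  multiset serves all fillings of the rest.\<close>

definition block_literals :: "comparator_circuit \<Rightarrow> nat \<Rightarrow> nat \<Rightarrow> nat \<Rightarrow> (nat set \<Rightarrow> bool) multiset" where
  "block_literals C m \<kappa> u =
     image_mset (\<lambda>i h. lit_value (block_table m \<kappa> {u} (\<lambda>_. h)) (wire_labels C ! i))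
       (mset_set (block_wires C \<kappa> u))"

lemma length_block_table [simp]: "length (block_table m \<kappa> U x) = 2 ^ m"
  by (simp add: block_table_def)

lemma nth_block_table:
  "v < 2 ^ m \<Longrightarrow> block_table m \<kappa> U x ! v \<longleftrightarrow> v div 2 ^ \<kappa> \<in> U \<and> v mod 2 ^ \<kappa> \<in> x (v div 2 ^ \<kappa>)"
  by (simp add: block_table_def)

lemma block_table_cong: "(\<And>u. u \<in> U \<Longrightarrow> x u = x' u) \<Longrightarrow> block_table m \<kappa> U x = block_table m \<kappa> U x'"
  by (auto simp: block_table_def)

lemma lit_value_cong: "a ! lit_var l = b ! lit_var l \<Longrightarrow> lit_value a l = lit_value b l"
  by (cases l) auto

text \<open>Once everything outside block \<open>u\<close> is fixed, the wires of the block carry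
  \<open>block_literals\<close> and all other relevant wires are constant, so
  \<open>function_gates_output\<close> applies. The resulting set does not depend on
  \<open>x\<close>, hence a single choice of tables can fool all hybrids.\<close>

lemma residual_in_comparator_outputs:
  assumes wf: "wf_comparator_circuit (2 ^ m) C" and "u \<in> U"
  shows "(\<lambda>h. comparator_eval C (block_table m \<kappa> U (x(u := h)))) \<in>
    comparator_outputs (block_literals C m \<kappa> u)"
proof -
  let ?A = "relevant_wires C" and ?B = "block_wires C \<kappa> u"
  define G where "G i h = lit_value (block_table m \<kappa> U (x(u := h))) (wire_labels C ! i)" for i h
  have A: "i < length (wire_labels C)" "lit_var (wire_labels C ! i) < 2 ^ m" if "i \<in> ?A" for i
  proof -
    show "i < length (wire_labels C)"
      using that wf by (auto simp: relevant_wires_def wf_comparator_circuit_def)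
    then show "lit_var (wire_labels C ! i) < 2 ^ m"
      using wf by (auto simp: wf_comparator_circuit_def)
  qed
  have gates: "\<forall>(i, j)\<in>set (cgates C). i \<in> ?A \<and> j \<in> ?A \<and> i \<noteq> j"
  proof (clarify)
    fix i j assume ij: "(i, j) \<in> set (cgates C)"
    then have "i \<in> fst ` set (cgates C)" "j \<in> snd ` set (cgates C)"
      by (auto intro: image_eqI[of _ _ "(i, j)"])
    moreover have "i \<noteq> j" using wf ij by (auto simp: wf_comparator_circuit_def)
    ultimately show "i \<in> ?A \<and> j \<in> ?A \<and> i \<noteq> j" by (simp add: relevant_wires_def)
  qed
  have AB: "?A = ?B \<union> (?A - ?B)" by (auto simp: block_wires_def)
  have "image_mset G (mset_set ?A) = image_mset G (mset_set ?B) + image_mset G (mset_set (?A - ?B))"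
    by (subst AB, subst mset_set_Union) (auto simp: finite_relevant_wires block_wires_def)
  also have "image_mset G (mset_set ?B) = block_literals C m \<kappa> u"
    unfolding block_literals_def
  proof (rule image_mset_cong)
    fix i assume "i \<in># mset_set ?B"
    then have i: "i \<in> ?A" "lit_var (wire_labels C ! i) div 2 ^ \<kappa> = u"
      using finite_relevant_wires[of C] by (auto simp: block_wires_def)
    show "G i = (\<lambda>h. lit_value (block_table m \<kappa> {u} (\<lambda>_. h)) (wire_labels C ! i))"
      unfolding G_def using A(2)[OF i(1)] i(2) \<open>u \<in> U\<close>
      by (intro ext lit_value_cong) (simp add: nth_block_table)
  qed
  finally have split: "image_mset G (mset_set ?A) =
    block_literals C m \<kappa> u + image_mset G (mset_set (?A - ?B))" .
  have const: "set_mset (image_mset G (mset_set (?A - ?B))) \<subseteq> {bot, top}"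
  proof
    fix g assume "g \<in> set_mset (image_mset G (mset_set (?A - ?B)))"
    then obtain i where i: "i \<in> ?A" "lit_var (wire_labels C ! i) div 2 ^ \<kappa> \<noteq> u" "g = G i"
      using finite_relevant_wires[of C] by (auto simp: block_wires_def)
    have "G i h = G i {}" for h
      unfolding G_def using A(2)[OF i(1)] i(2) by (intro lit_value_cong) (simp add: nth_block_table)
    then have "G i = (\<lambda>_. G i {})" by auto
    then show "g \<in> {bot, top}"
      unfolding i(3) by (cases "G i {}") (auto simp: bot_fun_def top_fun_def)
  qed
  have "comparator_eval C (block_table m \<kappa> U (x(u := h))) =
      fold function_gate (cgates C) G (output_wire C) h" for h
    unfolding comparator_eval_def
    using wf by (intro fold_cgate_step_eq_function_gate) (auto simp: G_def wf_comparator_circuit_def)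
  moreover have "fold function_gate (cgates C) G (output_wire C) \<in> comparator_outputs (block_literals C m \<kappa> u)"
    by (rule function_gates_output[OF finite_relevant_wires gates split const])
      (simp add: relevant_wires_def)
  ultimately show ?thesis by simp
qed

text \<open>Every wire is labelled by one literal and so belongs to one block only.\<close>

lemma sum_card_block_wires:
  "(\<Sum>u<N. card (block_wires C \<kappa> u)) \<le> 2 * comparator_size C + 1"
proof -
  have "(\<Sum>u<N. card (block_wires C \<kappa> u)) = card (\<Union>u<N. block_wires C \<kappa> u)"
    by (subst card_UN_disjoint) (auto simp: block_wires_def finite_relevant_wires)
  also have "\<dots> \<le> card (relevant_wires C)"
    by (intro card_mono finite_relevant_wires) (auto simp: block_wires_def)
  finally show ?thesis using card_relevant_wires[of C] by simp
qed

text \<open>By \<open>load\<close>, the blocks with more than \<open>l\<close> wires are at most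
  half of all \<open>2 ^ (m - \<kappa>)\<close> blocks, and \<open>T\<close> is at most the other
  half. The factor \<open>2 ^ (\<kappa> + 1)\<close> clears the denominators.\<close>

lemma light_blocks:
  assumes "\<kappa> \<le> m" and load: "2 ^ (\<kappa> + 1) * (2 * comparator_size C + 1) \<le> (l + 1) * 2 ^ m"
    and T: "T * 2 ^ (\<kappa> + 1) \<le> 2 ^ m"
  obtains U where "U \<subseteq> {..<2 ^ (m - \<kappa>)}" "card U = T" "\<And>u. u \<in> U \<Longrightarrow> card (block_wires C \<kappa> u) \<le> l"
proof -
  let ?N = "2 ^ (m - \<kappa>) :: nat"
  let ?H = "{u \<in> {..<?N}. l < card (block_wires C \<kappa> u)}"
  let ?L = "{u \<in> {..<?N}. card (block_wires C \<kappa> u) \<le> l}"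
  have "(l + 1) * card ?H \<le> (\<Sum>u\<in>?H. card (block_wires C \<kappa> u))"
    using sum_bounded_below[of ?H "l + 1" "\<lambda>u. card (block_wires C \<kappa> u)"] by (simp add: mult.commute)
  also have "\<dots> \<le> (\<Sum>u<?N. card (block_wires C \<kappa> u))" by (intro sum_mono2) auto
  also have "\<dots> \<le> 2 * comparator_size C + 1" by (rule sum_card_block_wires)
  finally have "2 ^ (\<kappa> + 1) * ((l + 1) * card ?H) \<le> (l + 1) * 2 ^ m"
    using load by (meson mult_le_mono2 order_trans)
  then have "(l + 1) * (2 ^ (\<kappa> + 1) * card ?H) \<le> (l + 1) * 2 ^ m"
    by (simp only: mult.left_commute)
  then have H: "2 ^ (\<kappa> + 1) * card ?H \<le> 2 ^ m" by (simp only: mult_le_cancel1)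
  have "?H \<union> ?L = {..<?N}" "?H \<inter> ?L = {}" by auto
  then have "card ?H + card ?L = card {..<?N}"
    using card_Un_disjoint[of ?H ?L] by simp
  from arg_cong[OF this, of "(*) (2 ^ (\<kappa> + 1))"]
  have "2 ^ (\<kappa> + 1) * card ?H + 2 ^ (\<kappa> + 1) * card ?L = 2 ^ (\<kappa> + 1) * ?N"
    by (simp only: distrib_left card_lessThan)
  also have "\<dots> = 2 * 2 ^ m" using \<open>\<kappa> \<le> m\<close> by (simp flip: power_add)
  finally have "2 ^ m \<le> 2 ^ (\<kappa> + 1) * card ?L" using H by linarith
  from order_trans[OF T this] have "2 ^ (\<kappa> + 1) * T \<le> 2 ^ (\<kappa> + 1) * card ?L"
    by (simp only: mult.commute)
  then have "T \<le> card ?L" by (rule mult_left_le_imp_le) simp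
  then obtain U where "U \<subseteq> ?L" "card U = T" by (meson obtain_subset_with_card_n)
  then show ?thesis using that by blast
qed

text \<open>The content of block \<open>u\<close> can be read off at the positions
  \<open>u * 2 ^ \<kappa> + v\<close>, all of which lie inside the table. This carries the count of
  accepted fillings over to tables.\<close>

lemma inj_on_block_table:
  assumes "\<kappa> \<le> m" "U \<subseteq> {..<2 ^ (m - \<kappa>)}"
  shows "inj_on (block_table m \<kappa> U) (U \<rightarrow>\<^sub>E Pow {..<2 ^ \<kappa>})"
proof (rule inj_onI)
  fix x y assume x: "x \<in> U \<rightarrow>\<^sub>E Pow {..<2 ^ \<kappa>}" and y: "y \<in> U \<rightarrow>\<^sub>E Pow {..<2 ^ \<kappa>}"
    and eq: "block_table m \<kappa> U x = block_table m \<kappa> U y"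
  have "x u = y u" if u: "u \<in> U" for u
  proof -
    have "v \<in> x u \<longleftrightarrow> v \<in> y u" if v: "v < 2 ^ \<kappa>" for v
    proof -
      have "u + 1 \<le> 2 ^ (m - \<kappa>)" using u assms(2) by auto
      then have "(u + 1) * 2 ^ \<kappa> \<le> 2 ^ (m - \<kappa>) * 2 ^ \<kappa>" by (rule mult_le_mono1)
      then have "u * 2 ^ \<kappa> + v < 2 ^ m"
        using v \<open>\<kappa> \<le> m\<close> by (simp flip: power_add)
      then show ?thesis
        using arg_cong[OF eq, of "\<lambda>t. t ! (u * 2 ^ \<kappa> + v)"] u v by (simp add: nth_block_table)
    qed
    moreover have "x u \<subseteq> {..<2 ^ \<kappa>}" "y u \<subseteq> {..<2 ^ \<kappa>}" using x y u by (auto simp: PiE_iff)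
    ultimately show ?thesis by blast
  qed
  then show "x = y" by (rule PiE_ext[OF x y])
qed

section \<open>Contradiction by counting accepted tables\<close>

lemma card_small_tables_le:
  assumes "0 < m" "m + s \<le> 2 ^ m"
  shows "card (small_tables m s) \<le> 2 ^ (m * (4 * s + 1))"
proof -
  have "(m + s)\<^sup>2 \<le> (2 ^ m)\<^sup>2" using assms by (intro power_mono) auto
  moreover have "(4::nat) \<le> 2 ^ (2 * m)" using assms power_increasing[of 2 "2 * m" "2::nat"] by simp
  ultimately have "4 * (m + s)\<^sup>2 \<le> 2 ^ (2 * m) * (2 ^ m)\<^sup>2" by (rule mult_le_mono[rotated])
  also have "\<dots> = 2 ^ (4 * m)" by (simp flip: power_mult power_add)
  finally have "(4 * (m + s)\<^sup>2) ^ s * (m + s) \<le> (2 ^ (4 * m)) ^ s * 2 ^ m"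
    using assms by (intro mult_le_mono power_mono) auto
  also have "\<dots> = 2 ^ (m * (4 * s + 1))"
    by (simp add: algebra_simps flip: power_mult power_add)
  finally show ?thesis using small_tables_finite_card[OF \<open>0 < m\<close>, of s] by simp
qed

text \<open>The combinatorial core with free parameters: \<open>load\<close> and \<open>T\<close>
  provide light blocks, \<open>p\<close> bounds the number of residual functions by
  \<open>(2 ^ m) ^ p\<close>, \<open>R\<close> makes the tables large enough for sampling,
  \<open>easy\<close> makes the XOR strings small, and \<open>hard\<close> makes small tables fewer
  than half of all fillings.\<close>

lemma no_comparator_circuit:
  fixes C :: comparator_circuit and m \<kappa> \<rho> c p l T S :: nat
  assumes wf: "wf_comparator_circuit (2 ^ m) C"
    and \<kappa>: "0 < \<kappa>" "\<kappa> < m"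
    and load: "2 ^ (\<kappa> + 1) * (2 * comparator_size C + 1) \<le> (l + 1) * 2 ^ m"
    and T: "0 < T" "T * 2 ^ (\<kappa> + 1) \<le> 2 ^ m"
    and p: "l\<^sup>2 + 2 \<le> p" "p \<le> 2 ^ m"
    and R: "(2 ^ m) ^ 4 * (4 * p) ^ c \<le> (2 ^ \<rho>) ^ c"
    and easy: "xor_circuit_size m \<kappa> \<rho> c T \<le> S"
    and hard: "m + S \<le> 2 ^ m" "m * (4 * S + 1) + 1 < T * 2 ^ \<kappa>"
    and decides: "\<And>t. length t = 2 ^ m \<Longrightarrow> comparator_eval C t \<longleftrightarrow> t \<in> small_tables m S"
  shows False
proof -
  define n :: real where "n = 2 ^ m"
  define r :: real where "r = 2 ^ \<rho>"
  \<comment> \<open>Over the \<open>T\<close> hybrid steps, the total loss is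
    \<open>1 / 2\<close>.\<close>
  define \<eta> :: real where "\<eta> = 1 / (2 * T)"
  let ?K = "{..<2 ^ \<kappa>} :: nat set" and ?Z = "{..<c} \<rightarrow>\<^sub>E {..<2 ^ \<rho>} :: (nat \<Rightarrow> nat) set"
  obtain U where U: "U \<subseteq> {..<2 ^ (m - \<kappa>)}" "card U = T"
    and light: "\<And>u. u \<in> U \<Longrightarrow> card (block_wires C \<kappa> u) \<le> l"
    using light_blocks[OF less_imp_le[OF \<kappa>(2)] load T(2)] by blast
  have finU: "finite U" using U(1) by (rule finite_subset) simp
  let ?O = "\<lambda>u. comparator_outputs (block_literals C m \<kappa> u)"
  define F where "F = (\<Union>u\<in>U. ?O u)"
  \<comment> \<open>The exponent is \<open>p - 1\<close>, which leaves one factor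
    \<open>2 ^ m\<close> for the union over the \<open>T\<close> blocks.\<close>
  have cardO: "card (?O u) \<le> (2 ^ m) ^ (p - 1)" if "u \<in> U" for u
  proof -
    define q where "q = (size (block_literals C m \<kappa> u))\<^sup>2"
    have "size (block_literals C m \<kappa> u) \<le> l" using light[OF that] by (simp add: block_literals_def)
    then have "q \<le> l\<^sup>2" unfolding q_def by (intro power_mono) auto
    then have q: "q + 2 \<le> 2 ^ m" "q + 1 \<le> p - 1" using p by auto
    have "card (?O u) \<le> (q + 2) ^ (q + 1)"
      using comparator_outputs_finite_card[of "block_literals C m \<kappa> u"] by (simp add: q_def)
    also have "\<dots> \<le> (2 ^ m) ^ (q + 1)" using q(1) by (intro power_mono) auto
    also have "\<dots> \<le> (2 ^ m) ^ (p - 1)" using q(2) by (intro power_increasing) auto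
    finally show ?thesis .
  qed
  have finF: "finite F" unfolding F_def using finU comparator_outputs_finite_card by blast
  have "2 * T \<le> T * 2 ^ (\<kappa> + 1)" by simp
  then have T2: "2 * T \<le> 2 ^ m" using T(2) by linarith
  have "card F \<le> (\<Sum>u\<in>U. card (?O u))" unfolding F_def by (rule card_UN_le[OF finU])
  also have "\<dots> \<le> T * (2 ^ m) ^ (p - 1)"
    using sum_bounded_above[of U "\<lambda>u. card (?O u)" "(2 ^ m) ^ (p - 1)"] cardO U(2) by simp
  also have "\<dots> < 2 ^ m * (2 ^ m) ^ (p - 1)" using T2 T(1) by (intro mult_strict_right_mono) auto
  also have "\<dots> = (2 ^ m) ^ p" using p(1) by (cases p) auto
  finally have "real (card F) < real ((2 ^ m) ^ p)" by (simp only: of_nat_less_iff)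
  then have cardF: "card F < n ^ p" by (simp add: n_def)
  have n1: "1 \<le> n" and r0: "0 < r" and \<eta>0: "0 < \<eta>" using T(1) by (auto simp: n_def r_def \<eta>_def)

  \<comment> \<open>Of the factor \<open>n ^ 4\<close> in \<open>R\<close>, one \<open>n\<close>
    pays for \<open>card F\<close>, two pay for the square of \<open>\<eta>\<close>, as
    \<open>1 / n \<le> \<eta>\<close>, and one is to spare.\<close>
  have small: "card F * (4 * real p * real (2 ^ \<rho>)) ^ (p * c) < (\<eta> * real (2 ^ \<rho>) ^ c) ^ (2 * p)"
  proof -
    have "real ((2 ^ m) ^ 4 * (4 * p) ^ c) \<le> real ((2 ^ \<rho>) ^ c)" using R by (simp only: of_nat_le_iff)
    then have R': "n ^ 4 * (4 * real p) ^ c \<le> r ^ c" by (simp add: n_def r_def)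
    have "real (2 * T) \<le> real (2 ^ m)" using T2 by (simp only: of_nat_le_iff)
    then have "1 / n \<le> \<eta>" using T(1) by (simp add: n_def \<eta>_def field_simps)
    have "(4 * real p * r) ^ (p * c) = ((4 * real p) ^ c * r ^ c) ^ p"
      by (simp add: power_mult mult.commute[of p] power_mult_distrib)
    moreover have "0 < (4 * real p * r) ^ (p * c)" using p(1) r0 by simp
    ultimately have "card F * (4 * real p * r) ^ (p * c) < n ^ p * ((4 * real p) ^ c * r ^ c) ^ p"
      using cardF by (simp add: mult_strict_right_mono)
    also have "\<dots> = (n * ((4 * real p) ^ c * r ^ c)) ^ p" by (simp add: power_mult_distrib)
    also have "\<dots> \<le> ((\<eta> * r ^ c)\<^sup>2) ^ p"
    proof (rule power_mono)
      have "n * ((4 * real p) ^ c * r ^ c) = (1 / n) ^ 3 * (n ^ 4 * (4 * real p) ^ c) * r ^ c"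
        using n1 by (simp add: power_divide power_numeral_reduce)
      also have "\<dots> \<le> (1 / n) ^ 3 * r ^ c * r ^ c"
        using R' n1 r0 by (intro mult_right_mono mult_left_mono) auto
      also have "\<dots> \<le> (1 / n) ^ 2 * r ^ c * r ^ c"
        using n1 r0 by (intro mult_right_mono power_decreasing) auto
      also have "\<dots> \<le> \<eta> ^ 2 * r ^ c * r ^ c"
        using \<open>1 / n \<le> \<eta>\<close> n1 r0 by (intro mult_right_mono power_mono) auto
      finally show "n * ((4 * real p) ^ c * r ^ c) \<le> (\<eta> * r ^ c)\<^sup>2"
        by (simp add: power2_eq_square mult_ac)
    qed (use n1 r0 in auto)
    finally show ?thesis by (simp add: r_def power_mult)
  qed
  obtain X where X: "X \<in> xor_tables c (2 ^ \<rho>) ?K"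
    and sample: "\<And>f. f \<in> F \<Longrightarrow> average ?Z (\<lambda>z. of_bool (f (table_xor c X z)))
        \<le> average (Pow ?K) (\<lambda>h. of_bool (f h)) + \<eta>"
    using table_xor_sampler[OF _ finF \<eta>0 small, of ?K] by blast

  define A where "A x = (of_bool (comparator_eval C (block_table m \<kappa> U x)) :: real)" for x
  let ?x = "\<lambda>x i. if i \<in> U then x i else {}"
  have "average (U \<rightarrow>\<^sub>E ?Z) (\<lambda>z. A (\<lambda>i. if i \<in> U then table_xor c X (z i) else {}))
    \<le> average (U \<rightarrow>\<^sub>E Pow ?K) (\<lambda>x. A (?x x)) + card U * \<eta>"
  proof (rule hybrid_argument[OF finU, where A = A and d = "table_xor c X" and b = "\<lambda>_. {}"])
    show "finite ?Z" by (intro finite_PiE) auto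
    show "?Z \<noteq> {}" by (auto simp: PiE_eq_empty_iff lessThan_empty_iff)
    \<comment> \<open>Here \<open>x\<close> is arbitrary, since \<open>F\<close> contains the
      residual functions for every filling of the other blocks.\<close>
    fix u x assume "u \<in> U"
    then have "(\<lambda>h. comparator_eval C (block_table m \<kappa> U (x(u := h)))) \<in> F"
      using residual_in_comparator_outputs[OF wf \<open>u \<in> U\<close>] unfolding F_def by blast
    from sample[OF this] show "average ?Z (\<lambda>z. A (x(u := table_xor c X z)))
        \<le> average (Pow ?K) (\<lambda>h. A (x(u := h))) + \<eta>"
      by (simp add: A_def)
  qed auto
  \<comment> \<open>All tables made of XORs have circuits of size at most \<open>S\<close>, so the
    comparator circuit accepts every one of them.\<close>
  moreover have "average (U \<rightarrow>\<^sub>E ?Z) (\<lambda>z. A (\<lambda>i. if i \<in> U then table_xor c X (z i) else {})) = 1"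
  proof -
    have "A (\<lambda>i. if i \<in> U then table_xor c X (z i) else {}) = 1" if z: "z \<in> U \<rightarrow>\<^sub>E ?Z" for z
    proof -
      have "block_table m \<kappa> U (\<lambda>u. table_xor c X (z u)) \<in>
          small_tables m (xor_circuit_size m \<kappa> \<rho> c (card U))"
        using z by (intro block_table_xor_small \<kappa> finU) (auto simp: PiE_iff)
      then have "block_table m \<kappa> U (\<lambda>u. table_xor c X (z u)) \<in> small_tables m S"
        using easy U(2) unfolding small_tables_def by fastforce
      moreover have "block_table m \<kappa> U (\<lambda>u. table_xor c X (z u)) =
          block_table m \<kappa> U (\<lambda>i. if i \<in> U then table_xor c X (z i) else {})"
        by (rule block_table_cong) simp
      ultimately show ?thesis using decides by (simp add: A_def)
    qed
    moreover have "finite (U \<rightarrow>\<^sub>E ?Z)" "U \<rightarrow>\<^sub>E ?Z \<noteq> {}"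
      using finU by (auto intro!: finite_PiE simp: PiE_eq_empty_iff lessThan_empty_iff)
    ultimately show ?thesis by (simp add: average_def)
  qed
  moreover have "card U * \<eta> = 1 / 2" using U(2) T(1) by (simp add: \<eta>_def)
  moreover have "A (?x x) = A x" for x
    unfolding A_def by (subst block_table_cong[of U "?x x" x]) auto
  \<comment> \<open>So at least half of all fillings of the chosen blocks are accepted, although
    each accepted one must be a small table.\<close>
  ultimately have half: "1 / 2 \<le> average (U \<rightarrow>\<^sub>E Pow ?K) A" by simp
  let ?E = "U \<rightarrow>\<^sub>E Pow ?K"
  have finE: "finite ?E" using finU by (intro finite_PiE) auto
  have cardE: "card ?E = 2 ^ (T * 2 ^ \<kappa>)"
    using finU U(2) by (simp add: card_PiE card_Pow power_mult mult.commute flip: power_mult)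
  have "(\<Sum>x\<in>?E. A x) = card {x \<in> ?E. comparator_eval C (block_table m \<kappa> U x)}"
    using finE by (simp add: A_def Int_def)
  also have "\<dots> \<le> card (small_tables m S)"
  proof -
    have "inj_on (block_table m \<kappa> U) {x \<in> ?E. comparator_eval C (block_table m \<kappa> U x)}"
      by (rule inj_on_subset[OF inj_on_block_table]) (use \<kappa> U(1) in auto)
    moreover have "finite (small_tables m S)" using small_tables_finite_card[of m S] \<kappa> by simp
    ultimately show ?thesis
      using decides by (intro of_nat_mono card_inj_on_le) auto
  qed
  also have "\<dots> \<le> real (2 ^ (m * (4 * S + 1)))"
    using card_small_tables_le[of m S] \<kappa> hard(1) by (intro of_nat_mono) auto
  finally have "1 / 2 * real (card ?E) \<le> real (2 ^ (m * (4 * S + 1)))"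
    using half cardE by (simp add: average_def pos_le_divide_eq)
  then have "real (2 ^ (T * 2 ^ \<kappa>)) \<le> real (2 ^ (m * (4 * S + 1) + 1))"
    unfolding cardE by simp
  then have "(2::nat) ^ (T * 2 ^ \<kappa>) \<le> 2 ^ (m * (4 * S + 1) + 1)" by (simp only: of_nat_le_iff)
  then have "T * 2 ^ \<kappa> \<le> m * (4 * S + 1) + 1" by (rule power_le_imp_le_exp[rotated]) simp
  then show False using hard(2) by simp
qed

section \<open>Asymptotics\<close>

text \<open>Circuit sizes are integers, so the real bound may be rounded down.\<close>

lemma MCSP_iff_small_tables:
  assumes "length t = 2 ^ m" "0 \<le> s (2 ^ m)"
  shows "t \<in> MCSP s \<longleftrightarrow> t \<in> small_tables m (nat \<lfloor>s (2 ^ m)\<rfloor>)"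
proof -
  have "real b \<le> s (2 ^ m) \<longleftrightarrow> b \<le> nat \<lfloor>s (2 ^ m)\<rfloor>" for b
    using assms(2) by (simp add: le_nat_iff le_floor_iff)
  then show ?thesis
    using assms(1) by (auto simp: MCSP_def small_tables_def)
qed

section \<open>Rounding and the choice of parameters\<close>

lemma power_nat_ceiling_log:
  fixes y :: real
  assumes "1 \<le> y"
  shows "y \<le> 2 ^ nat \<lceil>log 2 y\<rceil>" "2 ^ nat \<lceil>log 2 y\<rceil> \<le> 2 * y"
proof -
  have eq: "2 ^ nat \<lceil>log 2 y\<rceil> = (2::real) powr \<lceil>log 2 y\<rceil>"
    using assms by (simp add: powr_realpow[symmetric] zero_le_log_cancel_iff)
  have "2 powr log 2 y \<le> (2::real) powr \<lceil>log 2 y\<rceil>" by (intro powr_mono) auto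
  then show "y \<le> 2 ^ nat \<lceil>log 2 y\<rceil>" using assms eq by simp
  have "(2::real) powr \<lceil>log 2 y\<rceil> \<le> 2 powr (log 2 y + 1)" by (intro powr_mono) (linarith, simp)
  then show "2 ^ nat \<lceil>log 2 y\<rceil> \<le> 2 * y" using assms eq by (simp add: powr_add)
qed

lemma power_nat_floor:
  fixes y :: real
  assumes "0 \<le> y"
  shows "2 powr y / 2 \<le> 2 ^ nat \<lfloor>y\<rfloor>" "2 ^ nat \<lfloor>y\<rfloor> \<le> 2 powr y"
proof -
  have eq: "2 ^ nat \<lfloor>y\<rfloor> = (2::real) powr \<lfloor>y\<rfloor>"
    using assms by (simp add: powr_realpow[symmetric])
  have "(2::real) powr (y - 1) \<le> 2 powr \<lfloor>y\<rfloor>" by (intro powr_mono) (linarith, simp)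
  then show "2 powr y / 2 \<le> 2 ^ nat \<lfloor>y\<rfloor>" unfolding eq by (simp add: powr_diff)
  show "2 ^ nat \<lfloor>y\<rfloor> \<le> 2 powr y" unfolding eq by (intro powr_mono) auto
qed

text \<open>Up to constants and logarithms, with \<open>x\<close> the table length, the lookups cost
  at most \<open>x powr (\<alpha> - 4 * \<delta>)\<close> and the pointers
  \<open>x powr (\<alpha> - \<delta> / 2)\<close>, both below \<open>x powr \<alpha>\<close>. The
  chosen blocks hold about \<open>x powr (\<alpha> + \<delta> / 2)\<close> bits, more than a
  description of a circuit of size \<open>x powr \<alpha>\<close>.\<close>

lemma comparator_lower_bound:
  fixes \<alpha> \<delta> :: real
  assumes \<delta>: "0 < \<delta>" "8 * \<delta> \<le> \<alpha>" "\<alpha> + 4 * \<delta> \<le> 1"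
  shows "\<exists>N. \<forall>n\<ge>N. \<forall>m. n = 2 ^ m \<longrightarrow>
    \<not> (\<exists>C. comparator_decides C n (MCSP (\<lambda>k. real k powr \<alpha>)) \<and>
           real (comparator_size C) \<le> real n powr (1 + \<alpha> / 2 - 4 * \<delta>))"
proof -
  \<comment> \<open>This constant makes \<open>(x powr \<delta>) ^ c\<close> at least
    \<open>x ^ 4\<close>, the excess that the sampler needs.\<close>
  define c where "c = nat \<lceil>4 / \<delta>\<rceil>"
  define c0 :: real where "c0 = (2 ^ (c + 1) + 2) * (real c + 2)"
  have "0 < \<alpha>" using \<delta> by linarith
  have c: "4 \<le> \<delta> * c" "0 < real c"
  proof -
    have "4 / \<delta> \<le> c" unfolding c_def by (rule of_nat_ceiling)
    then show "4 \<le> \<delta> * c" using \<delta>(1) by (simp add: field_simps)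
    then show "0 < real c" using \<delta>(1) by (cases "c = 0") auto
  qed
  have c0: "0 < c0" by (simp add: c0_def add_pos_pos)
  \<comment> \<open>These facts supply the inequalities behind the numerical hypotheses of
    \<open>no_comparator_circuit\<close>, with room for rounding.\<close>
  have "\<forall>\<^sub>F x::real in at_top. 1 < x \<and> 1 \<le> \<delta> * log 2 x"
    using \<delta>(1) by (intro eventually_conj) real_asymp+
  moreover have "\<forall>\<^sub>F x::real in at_top. 1 \<le> x powr (\<alpha> - \<delta> / 2) \<and> 2 * x powr (\<alpha> + \<delta> / 2) \<le> x"
    using \<delta> by (intro eventually_conj) real_asymp+
  moreover have "\<forall>\<^sub>F x::real in at_top. 36 * x powr (\<alpha> - 6 * \<delta>) + 2 \<le> x"
    using \<delta> by real_asymp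
  moreover have "\<forall>\<^sub>F x::real in at_top. 8 * (36 * x powr (\<alpha> - 6 * \<delta>) + 2) * x powr \<delta> \<le> x"
    using \<delta> by real_asymp
  moreover have "\<forall>\<^sub>F x::real in at_top.
      (c * log 2 x + 1) * ((x powr (\<alpha> - \<delta> / 2) + 2) * (log 2 x + 1)) +
      c * ((8 * (36 * x powr (\<alpha> - 6 * \<delta>) + 2) * x powr (2 * \<delta>) + 2) * (2 * log 2 x + 1)) + c0
        \<le> x powr \<alpha> - 1"
    using \<delta> c(2) c0 by real_asymp
  moreover have "\<forall>\<^sub>F x::real in at_top. log 2 x + x powr \<alpha> \<le> x"
    using \<delta> by real_asymp
  moreover have "\<forall>\<^sub>F x::real in at_top.
      log 2 x * (4 * x powr \<alpha> + 1) + 1 < (x powr (\<alpha> - \<delta> / 2) - 1) * (x powr \<delta> / 2)"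
    using \<delta> \<open>0 < \<alpha>\<close> by real_asymp
  ultimately have "\<forall>\<^sub>F x::real in at_top.
      1 < x \<and> 1 \<le> \<delta> * log 2 x \<and>
      1 \<le> x powr (\<alpha> - \<delta> / 2) \<and> 2 * x powr (\<alpha> + \<delta> / 2) \<le> x \<and>
      36 * x powr (\<alpha> - 6 * \<delta>) + 2 \<le> x \<and>
      8 * (36 * x powr (\<alpha> - 6 * \<delta>) + 2) * x powr \<delta> \<le> x \<and>
      (c * log 2 x + 1) * ((x powr (\<alpha> - \<delta> / 2) + 2) * (log 2 x + 1)) +
        c * ((8 * (36 * x powr (\<alpha> - 6 * \<delta>) + 2) * x powr (2 * \<delta>) + 2) * (2 * log 2 x + 1)) + c0
          \<le> x powr \<alpha> - 1 \<and>
      log 2 x + x powr \<alpha> \<le> x \<and>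
      log 2 x * (4 * x powr \<alpha> + 1) + 1 < (x powr (\<alpha> - \<delta> / 2) - 1) * (x powr \<delta> / 2)"
    by eventually_elim auto
  then obtain x0 :: real where x0: "\<And>x. x0 \<le> x \<Longrightarrow>
      1 < x \<and> 1 \<le> \<delta> * log 2 x \<and>
      1 \<le> x powr (\<alpha> - \<delta> / 2) \<and> 2 * x powr (\<alpha> + \<delta> / 2) \<le> x \<and>
      36 * x powr (\<alpha> - 6 * \<delta>) + 2 \<le> x \<and>
      8 * (36 * x powr (\<alpha> - 6 * \<delta>) + 2) * x powr \<delta> \<le> x \<and>
      (c * log 2 x + 1) * ((x powr (\<alpha> - \<delta> / 2) + 2) * (log 2 x + 1)) +
        c * ((8 * (36 * x powr (\<alpha> - 6 * \<delta>) + 2) * x powr (2 * \<delta>) + 2) * (2 * log 2 x + 1)) + c0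
          \<le> x powr \<alpha> - 1 \<and>
      log 2 x + x powr \<alpha> \<le> x \<and>
      log 2 x * (4 * x powr \<alpha> + 1) + 1 < (x powr (\<alpha> - \<delta> / 2) - 1) * (x powr \<delta> / 2)"
    unfolding eventually_at_top_linorder by blast
  have "False" if n: "nat \<lceil>x0\<rceil> \<le> n" and nm: "n = 2 ^ m"
    and dec: "comparator_decides C n (MCSP (\<lambda>k. real k powr \<alpha>))"
    and size: "real (comparator_size C) \<le> real n powr (1 + \<alpha> / 2 - 4 * \<delta>)" for n m C
  proof -
    define x :: real where "x = 2 ^ m"
    have xn: "real n = x" by (simp add: nm x_def)
    then have "x0 \<le> x" using n by linarith
    have lg: "log 2 x = m" by (simp add: x_def)
    note X = x0[OF \<open>x0 \<le> x\<close>, unfolded lg]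
    have x1: "1 < x" using X by blast
    have xpow: "x powr y = 2 powr (y * m)" for y
      by (simp add: x_def powr_powr mult.commute flip: powr_realpow)
    define \<kappa> where "\<kappa> = nat \<lfloor>\<delta> * m\<rfloor>"
    \<comment> \<open>The 6 is a factor 2 from \<open>2 ^ (\<kappa> + 1)\<close> and a factor 3 from
      bounding twice the size plus one.\<close>
    define l where "l = nat \<lfloor>6 * x powr (\<alpha> / 2 - 3 * \<delta>)\<rfloor>"
    define p where "p = l\<^sup>2 + 2"
    \<comment> \<open>The factor \<open>4 * p\<close> cancels the one in the moment bound, and
      \<open>x powr \<delta>\<close> is the gain per table.\<close>
    define \<rho> where "\<rho> = nat \<lceil>log 2 (4 * p * x powr \<delta>)\<rceil>"
    define T where "T = nat \<lfloor>x powr (\<alpha> - \<delta> / 2)\<rfloor>"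
    define S where "S = nat \<lfloor>x powr \<alpha>\<rfloor>"
    have k: "x powr \<delta> / 2 \<le> 2 ^ \<kappa>" "2 ^ \<kappa> \<le> x powr \<delta>"
      using power_nat_floor[of "\<delta> * m"] \<delta>(1) by (simp_all add: \<kappa>_def xpow)
    have fl: "y - 1 \<le> nat \<lfloor>y\<rfloor>" "nat \<lfloor>y\<rfloor> \<le> y" if "0 \<le> y" for y :: real
      using that by linarith+
    have T: "x powr (\<alpha> - \<delta> / 2) - 1 \<le> T" "T \<le> x powr (\<alpha> - \<delta> / 2)"
      unfolding T_def by (simp_all add: fl)
    have S: "x powr \<alpha> - 1 \<le> S" "S \<le> x powr \<alpha>"
      unfolding S_def by (simp_all add: fl)
    have l: "6 * x powr (\<alpha> / 2 - 3 * \<delta>) \<le> l + 1" "l \<le> 6 * x powr (\<alpha> / 2 - 3 * \<delta>)"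
      unfolding l_def using powr_ge_zero[of x "\<alpha> / 2 - 3 * \<delta>"] by linarith+
    have p: "real p \<le> 36 * x powr (\<alpha> - 6 * \<delta>) + 2"
    proof -
      have "(real l)\<^sup>2 \<le> (6 * x powr (\<alpha> / 2 - 3 * \<delta>))\<^sup>2" using l(2) by (intro power_mono) auto
      also have "\<dots> = 36 * (x powr (\<alpha> / 2 - 3 * \<delta>) * x powr (\<alpha> / 2 - 3 * \<delta>))"
        by (simp add: power2_eq_square)
      also have "\<dots> = 36 * x powr (\<alpha> - 6 * \<delta>)" by (simp flip: powr_add)
      finally show ?thesis by (simp add: p_def)
    qed
    have R: "4 * real p * x powr \<delta> \<le> 2 ^ \<rho>" "2 ^ \<rho> \<le> 8 * real p * x powr \<delta>"
    proof -
      have "1 \<le> x powr \<delta>" using x1 \<delta>(1) by (simp add: ge_one_powr_ge_zero)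
      moreover have "1 \<le> 4 * real p" by (simp add: p_def)
      ultimately have "1 \<le> 4 * real p * x powr \<delta>" using mult_mono[of 1 "4 * real p" 1] by simp
      from power_nat_ceiling_log[OF this]
      show "4 * real p * x powr \<delta> \<le> 2 ^ \<rho>" "2 ^ \<rho> \<le> 8 * real p * x powr \<delta>"
        by (simp_all add: \<rho>_def)
    qed
    have R2: "2 ^ \<rho> \<le> 8 * (36 * x powr (\<alpha> - 6 * \<delta>) + 2) * x powr \<delta>"
      using R(2) p by (elim order_trans) (intro mult_right_mono, auto)
    have "(2::real) ^ \<rho> \<le> 2 ^ m" using R2 X unfolding x_def[symmetric] by linarith
    then have \<rho>m: "\<rho> \<le> m" by simp
    have m0: "0 < m" using x1 by (cases m) (auto simp: x_def)
    have \<kappa>m: "0 < \<kappa>" "\<kappa> < m"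
    proof -
      show "0 < \<kappa>" using X by (simp add: \<kappa>_def)
      have "\<delta> * m < 1 * real m" using \<delta> m0 by (intro mult_strict_right_mono) auto
      then show "\<kappa> < m" using \<delta>(1) by (simp add: \<kappa>_def nat_less_iff floor_less_iff)
    qed
    have wf: "wf_comparator_circuit (2 ^ m) C"
      and eval: "\<And>a. length a = 2 ^ m \<Longrightarrow> comparator_eval C a = (a \<in> MCSP (\<lambda>k. real k powr \<alpha>))"
      using dec by (auto simp: comparator_decides_def nm)
    show False
    proof (rule no_comparator_circuit[OF wf \<kappa>m, of l T p c \<rho> S])
      have "1 \<le> x powr (1 + \<alpha> / 2 - 4 * \<delta>)" using x1 \<delta> by (intro ge_one_powr_ge_zero) auto
      then have "2 * real (comparator_size C) + 1 \<le> 3 * x powr (1 + \<alpha> / 2 - 4 * \<delta>)"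
        using size xn by simp
      then have "2 ^ (\<kappa> + 1) * (2 * real (comparator_size C) + 1) \<le>
          (2 * x powr \<delta>) * (3 * x powr (1 + \<alpha> / 2 - 4 * \<delta>))"
        using k(2) by (intro mult_mono) auto
      also have "\<dots> = 6 * x powr (\<delta> + (1 + \<alpha> / 2 - 4 * \<delta>))" by (simp only: powr_add)
      also have "\<delta> + (1 + \<alpha> / 2 - 4 * \<delta>) = (\<alpha> / 2 - 3 * \<delta>) + 1" by simp
      also have "6 * x powr ((\<alpha> / 2 - 3 * \<delta>) + 1) = (6 * x powr (\<alpha> / 2 - 3 * \<delta>)) * x"
        using x1 by (simp only: powr_add) simp
      also have "\<dots> \<le> (l + 1) * x" using l(1) x1 by (intro mult_right_mono) auto
      finally have "real (2 ^ (\<kappa> + 1) * (2 * comparator_size C + 1)) \<le> real ((l + 1) * 2 ^ m)"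
        by (simp only: x_def of_nat_mult of_nat_add of_nat_power of_nat_numeral of_nat_1)
      then show "2 ^ (\<kappa> + 1) * (2 * comparator_size C + 1) \<le> (l + 1) * 2 ^ m"
        by (simp only: of_nat_le_iff)
      show "0 < T" using X by (simp add: T_def)
      have "real T * 2 ^ (\<kappa> + 1) \<le> x powr (\<alpha> - \<delta> / 2) * (2 * x powr \<delta>)"
        using T(2) k(2) by (intro mult_mono) auto
      also have "\<dots> = 2 * x powr (\<alpha> + \<delta> / 2)" by (simp add: add.commute flip: powr_add)
      also have "\<dots> \<le> x" using X by blast
      finally have "real (T * 2 ^ (\<kappa> + 1)) \<le> real (2 ^ m)"
        by (simp only: x_def of_nat_mult of_nat_power of_nat_numeral)
      then show "T * 2 ^ (\<kappa> + 1) \<le> 2 ^ m" by (simp only: of_nat_le_iff)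
      show "l\<^sup>2 + 2 \<le> p" by (simp add: p_def)
      have "real p \<le> x" using p X by linarith
      then have "real p \<le> real (2 ^ m)" by (simp only: x_def of_nat_power of_nat_numeral)
      then show "p \<le> 2 ^ m" by (simp only: of_nat_le_iff)
      have "x ^ 4 = x powr 4" using x1 by (simp add: powr_numeral)
      also have "\<dots> \<le> x powr (\<delta> * c)" using x1 c(1) by (intro powr_mono) auto
      also have "\<dots> = (x powr \<delta>) ^ c" using x1 by (simp add: powr_powr flip: powr_realpow)
      finally have "x ^ 4 * (4 * real p) ^ c \<le> (x powr \<delta>) ^ c * (4 * real p) ^ c"
        by (intro mult_right_mono) auto
      also have "\<dots> = (4 * real p * x powr \<delta>) ^ c" by (simp add: power_mult_distrib mult_ac)
      also have "\<dots> \<le> (2 ^ \<rho>) ^ c" using R(1) by (intro power_mono) auto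
      finally have "real ((2 ^ m) ^ 4 * (4 * p) ^ c) \<le> real ((2 ^ \<rho>) ^ c)"
        by (simp only: x_def of_nat_mult of_nat_power of_nat_numeral)
      then show "(2 ^ m) ^ 4 * (4 * p) ^ c \<le> (2 ^ \<rho>) ^ c" by (simp only: of_nat_le_iff)
      have "(2::real) ^ (\<rho> + \<kappa>) \<le> 8 * (36 * x powr (\<alpha> - 6 * \<delta>) + 2) * x powr \<delta> * x powr \<delta>"
        unfolding power_add using R2 k(2) by (intro mult_mono) auto
      also have "\<dots> = 8 * (36 * x powr (\<alpha> - 6 * \<delta>) + 2) * x powr (2 * \<delta>)"
        by (simp add: mult.assoc flip: powr_add)
      finally have Rk: "(2::real) ^ (\<rho> + \<kappa>) \<le> 8 * (36 * x powr (\<alpha> - 6 * \<delta>) + 2) * x powr (2 * \<delta>)" .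
      have "real (xor_circuit_size m \<kappa> \<rho> c T) =
          (real c * real \<rho> + 1) * ((real T + 2) * (real m + 1)) +
          real c * ((2 ^ (\<rho> + \<kappa>) + 2) * (real \<rho> + real \<kappa> + 1)) + c0"
        by (simp only: xor_circuit_size_def c0_def of_nat_mult of_nat_add of_nat_power
            of_nat_numeral of_nat_1)
      also have "\<dots> \<le> (c * real m + 1) * ((x powr (\<alpha> - \<delta> / 2) + 2) * (real m + 1)) +
          c * ((8 * (36 * x powr (\<alpha> - 6 * \<delta>) + 2) * x powr (2 * \<delta>) + 2) * (2 * real m + 1)) + c0"
        using \<rho>m \<kappa>m(2) T(2) Rk by (intro add_mono mult_mono order_refl) auto
      \<comment> \<open>The margin 1 covers the rounding in \<open>S\<close>.\<close>
      also have "\<dots> \<le> x powr \<alpha> - 1" using X by blast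
      also have "\<dots> \<le> S" by (rule S(1))
      finally show "xor_circuit_size m \<kappa> \<rho> c T \<le> S" by (simp only: of_nat_le_iff)
      have "m + x powr \<alpha> \<le> x" using X by blast
      then have "real m + real S \<le> x" using S(2) by linarith
      then have "real (m + S) \<le> real (2 ^ m)"
        by (simp only: x_def of_nat_add of_nat_power of_nat_numeral)
      then show "m + S \<le> 2 ^ m" by (simp only: of_nat_le_iff)
      have "real m * (4 * real S + 1) + 1 \<le> m * (4 * x powr \<alpha> + 1) + 1"
        using S(2) by (intro add_right_mono mult_left_mono) auto
      also have "\<dots> < (x powr (\<alpha> - \<delta> / 2) - 1) * (x powr \<delta> / 2)" using X by blast
      also have "\<dots> \<le> real T * 2 ^ \<kappa>" using T(1) k(1) by (intro mult_mono) auto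
      finally have "real (m * (4 * S + 1) + 1) < real (T * 2 ^ \<kappa>)"
        by (simp only: of_nat_mult of_nat_add of_nat_power of_nat_numeral of_nat_1)
      then show "m * (4 * S + 1) + 1 < T * 2 ^ \<kappa>" by (simp only: of_nat_less_iff)
      fix t :: "bool list" assume "length t = 2 ^ m"
      then show "comparator_eval C t \<longleftrightarrow> t \<in> small_tables m S"
        using eval[of t] MCSP_iff_small_tables[of t m "\<lambda>k. real k powr \<alpha>"]
        by (simp add: S_def x_def)
    qed
  qed
  then show ?thesis by blast
qed

theorem theorem4:
  fixes \<epsilon> \<alpha> :: real
  assumes "\<epsilon> > 0" and "0 < \<alpha>" and "\<alpha> \<le> 1 - \<epsilon>"
  shows "\<exists>N::nat. \<forall>n\<ge>N. (\<exists>m::nat. n = 2 ^ m) \<longrightarrow>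
    \<not> (\<exists>C. comparator_decides C n (MCSP (\<lambda>k. real k powr \<alpha>)) \<and>
           real (comparator_size C) \<le> real n powr (1 + \<alpha> / 2 - \<epsilon>))"
proof -
  \<comment> \<open>The minimum with \<open>\<alpha> / 2\<close> secures
    \<open>8 * \<delta> \<le> \<alpha>\<close> even if \<open>\<epsilon>\<close> is large; a smaller
    \<open>\<epsilon>\<close> only strengthens the bound.\<close>
  define \<delta> where "\<delta> = min \<epsilon> (\<alpha> / 2) / 4"
  have \<delta>: "0 < \<delta>" "8 * \<delta> \<le> \<alpha>" "\<alpha> + 4 * \<delta> \<le> 1" "4 * \<delta> \<le> \<epsilon>"
    using assms by (auto simp: \<delta>_def min_def)
  obtain N where N: "\<And>n m C. N \<le> n \<Longrightarrow> n = 2 ^ m \<Longrightarrow>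
      comparator_decides C n (MCSP (\<lambda>k. real k powr \<alpha>)) \<Longrightarrow>
      \<not> real (comparator_size C) \<le> real n powr (1 + \<alpha> / 2 - 4 * \<delta>)"
    using comparator_lower_bound[OF \<delta>(1-3)] by blast
  have "real n powr (1 + \<alpha> / 2 - \<epsilon>) \<le> real n powr (1 + \<alpha> / 2 - 4 * \<delta>)" if "n = 2 ^ m" for n m :: nat
    using \<delta>(4) that by (intro powr_mono) auto
  then show ?thesis using N by (meson order_trans)
qed

end
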